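(* Let $\mathcal G$ be a finite-dimensional Lie algebra which acts, by an action $\varphi:\mathcal G\to A^1(N)$, on a smooth manifold $N$. Assume that $\varphi$ is locally transitive, i.e. for each $x\in N$, $\{\varphi(X)(x):X\in\mathcal G\}=T_xN$. Let $\widehat\varphi:\mathcal G\to A^1(T^*N)$ be the Hamiltonian action of $\mathcal G$ on $(T^*N,d\eta_N)$ which associates to each $X\in\mathcal G$ the canonical lift to $T^*N$ of the vector field $\varphi(X)$, and let $J:T^*N\to\mathcal G^*$ be the momentum map of $\widehat\varphi$ given by $$\langle J(\xi),X\rangle=\mathrm i\bigl(\widehat\varphi(X)\bigr)\eta_N(\xi),\quad X\in\mathcal G,\ \xi\in T^*N.$$ Let $H:T^*N\to\mathbb R$ be a smooth Hamiltonian which comes from a hyper-regular Lagrangian $L:TN\to\mathbb R$. Let $\psi:I\to T^*N$ be an integral curve of the Hamiltonian vector field $X_H$ defined on an open interval $I$, and let $V:I\to\mathcal G$ be a smooth parametrized curve which satisfies, for each $t\in I$, the compatibility condition $$\varphi\bigl(V(t)\bigr)\bigl(\pi_N\circ\psi(t)\bigr)=\frac{d(\pi_N\circ\psi(t))}{dt}.$$ Then the curve $J\circ\psi:I\to\mathcal G^*$ satisfies the differential equation in $\mathcal G^*$ (Euler–Poincaré equation) $$\Bigl(\frac{d}{dt}-\mathrm{ad}^*_{V(t)}\Bigr)\bigl(J\circ\psi(t)\bigr)=J\Bigl(d_1\overline L\bigl(\pi_N\circ\psi(t),V(t)\bigr)\Bigr),$$ where $\overline L:N\times\mathcal G\to\mathbb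 R$ is the map $\overline L(x,X)=L(\varphi(X)(x))$ and $d_1\overline L:N\times\mathcal G\to T^*N$ is the partial differential of $\overline L$ with respect to its first variable.
   Context: $A^1(N)$ is the Lie algebra of smooth vector fields on $N$; an action of $\mathcal G$ on $N$ is a Lie algebra homomorphism $\varphi:\mathcal G\to A^1(N)$. $\pi_N:T^*N\to N$ is the canonical projection, $\eta_N$ is the Liouville one-form ($\eta_N(w)=\langle\xi,T\pi_N(w)\rangle$ for $w\in T_\xi(T^*N)$; locally $\eta_N=\sum p_i\,dx^i$). The canonical lift to $T^*N$ of a diffeomorphism $F$ is $\widehat F=(TF^{-1})^T$, the transpose of $T(F^{-1})$; the canonical lift of a vector field $Z$ on $N$ is the vector field $\widehat Z$ on $T^*N$ whose flow is the canonical lift of the flow of $Z$. The action $\widehat\varphi$ is Hamiltonian, meaning each $\widehat\varphi(X)$ is a Hamiltonian vector field, and $J$ is a momentum map, meaning $\langle J,X\rangle$ is a Hamiltonian of $\widehat\varphi(X)$; explicitly $\langle J(\xi),X\rangle=\langle\xi,\varphi(X)(\pi_N(\xi))\rangle$. The Hamiltonian vector field $X_H$ is defined by $\mathrm i(X_H)d\eta_N=-dH$. The Legendre map $\mathcal L:TN\to T^*N$ of $L$ is its fibre derivative (locally $(x,v)\mapsto(x,\partial L/\partial v)$); $L$ is hyper-regular if $\mathcal L$ is a diffeomorphism, and the Hamiltonian which comes from $L$ is $H(\mathcal L(v))=\langle\mathcal L(v),v\rangle-L(v)$, $v\in TN$. $\mathrm{ad}^*_X:\mathcal G^*\to\mathcal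 G^*$ is the transpose of $\mathrm{ad}_X$: $\langle\mathrm{ad}^*_X\zeta,Y\rangle=\langle\zeta,[X,Y]\rangle$. *)

theory Defs
  imports "HOL-Analysis.Analysis"
begin

section \<open>Smooth maps between finite-dimensional normed spaces\<close>

text \<open>
  Model spaces are finite-dimensional normed spaces rather than Euclidean spaces: this includes
  dimension 0, and the class is closed under products and duals, which is what the model
  spaces of tangent and cotangent bundles need.
\<close>

definition finite_dimensional :: "'v::real_vector itself \<Rightarrow> bool" where
  "finite_dimensional _ \<longleftrightarrow> (\<exists>B::'v set. finite B \<and> span B = UNIV)"

text \<open>
  The set \<open>S\<close> is always open and the domain finite-dimensional in what follows; then continuity
  of all iterated directional derivatives is continuity of the iterated Frechet derivatives.
\<close>

primrec Ck_on :: "nat \<Rightarrow> 'v::real_normed_vector set \<Rightarrow> ('v \<Rightarrow> 'w::real_normed_vector) \<Rightarrow> bool" where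
  "Ck_on 0 S f \<longleftrightarrow> continuous_on S f"
| "Ck_on (Suc k) S f \<longleftrightarrow>
     (\<forall>x\<in>S. f differentiable (at x)) \<and> (\<forall>v. Ck_on k S (\<lambda>x. frechet_derivative f (at x) v))"

definition smooth_on :: "'v::real_normed_vector set \<Rightarrow> ('v \<Rightarrow> 'w::real_normed_vector) \<Rightarrow> bool" where
  "smooth_on S f \<longleftrightarrow> (\<forall>k. Ck_on k S f)"

definition open_interval :: "real set \<Rightarrow> bool" where
  "open_interval I \<longleftrightarrow> open I \<and> is_interval I"


section \<open>Smooth manifolds\<close>

text \<open>
  A manifold is given by an atlas; its set of points is the union of the chart domains and its
  topology is the one for which the charts are homeomorphisms. The atlas need not be maximal:
  all notions below depend only on the differentiable structure that it generates.
\<close>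

datatype ('a, 'e) chart = Chart (cdom: "'a set") (coord: "'a \<Rightarrow> 'e")

type_synonym ('a, 'e) atlas = "('a, 'e) chart set"

definition chart_inv :: "('a, 'e) chart \<Rightarrow> 'e \<Rightarrow> 'a" where
  "chart_inv c = inv_into (cdom c) (coord c)"

definition points :: "('a, 'e) atlas \<Rightarrow> 'a set" where
  "points A = (\<Union>c\<in>A. cdom c)"

definition charts_at :: "('a, 'e) atlas \<Rightarrow> 'a \<Rightarrow> ('a, 'e) chart set" where
  "charts_at A x = {c \<in> A. x \<in> cdom c}"

definition smooth_atlas :: "('a, 'e::real_normed_vector) atlas \<Rightarrow> bool" where
  "smooth_atlas A \<longleftrightarrow>
     (\<forall>c\<in>A. inj_on (coord c) (cdom c) \<and> open (coord c ` cdom c)) \<and>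
     (\<forall>c\<in>A. \<forall>d\<in>A. open (coord c ` (cdom c \<inter> cdom d)) \<and>
        smooth_on (coord c ` (cdom c \<inter> cdom d)) (coord d \<circ> chart_inv c))"

definition manifold_open :: "('a, 'e::real_normed_vector) atlas \<Rightarrow> 'a set \<Rightarrow> bool" where
  "manifold_open A U \<longleftrightarrow> U \<subseteq> points A \<and> (\<forall>c\<in>A. open (coord c ` (cdom c \<inter> U)))"

definition manifold_topology :: "('a, 'e::real_normed_vector) atlas \<Rightarrow> 'a topology" where
  "manifold_topology A = topology (manifold_open A)"

lemma openin_manifold_topology:
  assumes "smooth_atlas A"
  shows "openin (manifold_topology A) U \<longleftrightarrow> manifold_open A U"
proof -
  have inj: "inj_on (coord c) (cdom c)" if "c \<in> A" for c
    using assms that by (auto simp: smooth_atlas_def)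
  have "istopology (manifold_open A)"
    unfolding istopology_def
  proof (intro conjI allI impI)
    fix S T assume S: "manifold_open A S" and T: "manifold_open A T"
    have "coord c ` (cdom c \<inter> (S \<inter> T)) = coord c ` (cdom c \<inter> S) \<inter> coord c ` (cdom c \<inter> T)"
      if "c \<in> A" for c
      using inj[OF that] by (auto simp: inj_on_def)
    then show "manifold_open A (S \<inter> T)"
      using S T by (auto simp: manifold_open_def)
  next
    fix K assume K: "\<forall>S\<in>K. manifold_open A S"
    have eq: "coord c ` (cdom c \<inter> \<Union>K) = (\<Union>S\<in>K. coord c ` (cdom c \<inter> S))" for c :: "('a, 'b) chart"
      by blast
    show "manifold_open A (\<Union>K)"
      using K unfolding manifold_open_def eq by blast
  qed
  then show ?thesis
    by (simp add: manifold_topology_def topology_inverse')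
qed

definition smooth_manifold :: "('a, 'e::real_normed_vector) atlas \<Rightarrow> bool" where
  "smooth_manifold A \<longleftrightarrow>
     finite_dimensional TYPE('e) \<and> smooth_atlas A \<and>
     Hausdorff_space (manifold_topology A) \<and> second_countable (manifold_topology A)"

text \<open>An open subset of a vector space, as a manifold.\<close>

definition open_atlas :: "'v set \<Rightarrow> ('v, 'v) atlas" where
  "open_atlas U = {Chart U id}"

definition prod_atlas :: "('a, 'e) atlas \<Rightarrow> ('b, 'f) atlas \<Rightarrow> ('a \<times> 'b, 'e \<times> 'f) atlas" where
  "prod_atlas A B =
     {Chart (cdom c \<times> cdom d) (\<lambda>(x, y). (coord c x, coord d y)) |c d. c \<in> A \<and> d \<in> B}"

definition restrict_atlas :: "('a, 'e) atlas \<Rightarrow> 'a set \<Rightarrow> ('a, 'e) atlas" where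
  "restrict_atlas A U = {Chart (cdom c \<inter> U) (coord c) |c. c \<in> A}"

text \<open>Continuity is contained in the openness of the coordinate domains.\<close>

definition smooth_map ::
  "('a, 'e::real_normed_vector) atlas \<Rightarrow> ('b, 'f::real_normed_vector) atlas \<Rightarrow> ('a \<Rightarrow> 'b) \<Rightarrow> bool" where
  "smooth_map A B f \<longleftrightarrow>
     f ` points A \<subseteq> points B \<and>
     (\<forall>c\<in>A. \<forall>d\<in>B. open (coord c ` (cdom c \<inter> f -` cdom d)) \<and>
        smooth_on (coord c ` (cdom c \<inter> f -` cdom d)) (coord d \<circ> f \<circ> chart_inv c))"

definition diffeomorphism ::
  "('a, 'e::real_normed_vector) atlas \<Rightarrow> ('b, 'f::real_normed_vector) atlas \<Rightarrow> ('a \<Rightarrow> 'b) \<Rightarrow> bool" where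
  "diffeomorphism A B f \<longleftrightarrow>
     bij_betw f (points A) (points B) \<and> smooth_map A B f \<and> smooth_map B A (inv_into (points A) f)"


section \<open>Tangent and cotangent bundles\<close>

text \<open>
  A tangent vector at \<open>x\<close> is the family of its representatives in the charts around \<open>x\<close>, related
  by the derivatives of the transition maps. The value 0 at all other charts makes
  equality of families equality of tangent vectors; vector operations are chartwise.
\<close>

type_synonym ('a, 'e) tvec = "('a, 'e) chart \<Rightarrow> 'e"

type_synonym ('a, 'e) tbundle = "'a \<times> ('a, 'e) tvec"

definition tangent_space :: "('a, 'e::real_normed_vector) atlas \<Rightarrow> 'a \<Rightarrow> ('a, 'e) tvec set" where
  "tangent_space A x =
     {v. (\<forall>c\<in>charts_at A x. \<forall>d\<in>charts_at A x.
            v d = frechet_derivative (coord d \<circ> chart_inv c) (at (coord c x)) (v c)) \<and>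
         (\<forall>c. c \<notin> charts_at A x \<longrightarrow> v c = 0)}"

text \<open>The tangent vector at \<open>x\<close> whose representative in the chart \<open>c\<close> is \<open>u\<close>.\<close>

definition tvec_of ::
  "('a, 'e::real_normed_vector) atlas \<Rightarrow> 'a \<Rightarrow> ('a, 'e) chart \<Rightarrow> 'e \<Rightarrow> ('a, 'e) tvec" where
  "tvec_of A x c u =
     (\<lambda>d. if d \<in> charts_at A x
          then frechet_derivative (coord d \<circ> chart_inv c) (at (coord c x)) u else 0)"

definition tangent_chart ::
  "('a, 'e::real_normed_vector) atlas \<Rightarrow> ('a, 'e) chart \<Rightarrow> (('a, 'e) tbundle, 'e \<times> 'e) chart" where
  "tangent_chart A c =
     Chart {(x, v). x \<in> cdom c \<and> v \<in> tangent_space A x} (\<lambda>(x, v). (coord c x, v c))"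

definition tangent_atlas ::
  "('a, 'e::real_normed_vector) atlas \<Rightarrow> (('a, 'e) tbundle, 'e \<times> 'e) atlas" where
  "tangent_atlas A = tangent_chart A ` A"

text \<open>
  Covectors are linear functionals on the tangent space, extended by 0 to all families.
\<close>

type_synonym ('a, 'e) covec = "('a, 'e) tvec \<Rightarrow> real"

type_synonym ('a, 'e) ctbundle = "'a \<times> ('a, 'e) covec"

definition cotangent_space :: "('a, 'e::real_normed_vector) atlas \<Rightarrow> 'a \<Rightarrow> ('a, 'e) covec set" where
  "cotangent_space A x =
     {\<alpha>. (\<forall>v\<in>tangent_space A x. \<forall>w\<in>tangent_space A x. \<alpha> (\<lambda>c. v c + w c) = \<alpha> v + \<alpha> w) \<and>
         (\<forall>r. \<forall>v\<in>tangent_space A x. \<alpha> (\<lambda>c. r *\<^sub>R v c) = r * \<alpha> v) \<and>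
         (\<forall>v. v \<notin> tangent_space A x \<longrightarrow> \<alpha> v = 0)}"

definition cotangent_chart ::
  "('a, 'e::real_normed_vector) atlas \<Rightarrow> ('a, 'e) chart \<Rightarrow>
     (('a, 'e) ctbundle, 'e \<times> ('e \<Rightarrow>\<^sub>L real)) chart" where
  "cotangent_chart A c =
     Chart {(x, \<alpha>). x \<in> cdom c \<and> \<alpha> \<in> cotangent_space A x}
       (\<lambda>(x, \<alpha>). (coord c x, Blinfun (\<lambda>u. \<alpha> (tvec_of A x c u))))"

definition cotangent_atlas ::
  "('a, 'e::real_normed_vector) atlas \<Rightarrow> (('a, 'e) ctbundle, 'e \<times> ('e \<Rightarrow>\<^sub>L real)) atlas" where
  "cotangent_atlas A = cotangent_chart A ` A"

text \<open>
  In the next two definitions the result does not depend on the chart chosen by \<open>SOME\<close>, by the chain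
  rule. Only the germ of \<open>F\<close> at \<open>x\<close> matters, so locally defined maps are allowed.
\<close>

definition tangent_map ::
  "('a, 'e::real_normed_vector) atlas \<Rightarrow> ('b, 'f::real_normed_vector) atlas \<Rightarrow> ('a \<Rightarrow> 'b) \<Rightarrow>
     'a \<Rightarrow> ('a, 'e) tvec \<Rightarrow> ('b, 'f) tvec" where
  "tangent_map A B F x v =
     (let c = (SOME c. c \<in> charts_at A x) in
      (\<lambda>d. if d \<in> charts_at B (F x)
           then frechet_derivative (coord d \<circ> F \<circ> chart_inv c) (at (coord c x)) (v c) else 0))"

definition differential ::
  "('a, 'e::real_normed_vector) atlas \<Rightarrow> ('a \<Rightarrow> real) \<Rightarrow> 'a \<Rightarrow> ('a, 'e) covec" where
  "differential A f x v =
     (let c = (SOME c. c \<in> charts_at A x) in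
      if v \<in> tangent_space A x
      then frechet_derivative (f \<circ> chart_inv c) (at (coord c x)) (v c) else 0)"

definition velocity ::
  "('a, 'e::real_normed_vector) atlas \<Rightarrow> (real \<Rightarrow> 'a) \<Rightarrow> real \<Rightarrow> ('a, 'e) tvec" where
  "velocity A \<gamma> t =
     (\<lambda>c. if c \<in> charts_at A (\<gamma> t) then vector_derivative (coord c \<circ> \<gamma>) (at t) else 0)"


section \<open>Vector fields and flows\<close>

definition vector_field ::
  "('a, 'e::real_normed_vector) atlas \<Rightarrow> ('a \<Rightarrow> ('a, 'e) tvec) \<Rightarrow> bool" where
  "vector_field A Z \<longleftrightarrow> smooth_map A (tangent_atlas A) (\<lambda>x. (x, Z x))"

text \<open>The sign convention is that of the commutator of derivations, \<open>[X, Y] f = X (Y f) - Y (X f)\<close>.\<close>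

definition lie_bracket ::
  "('a, 'e::real_normed_vector) atlas \<Rightarrow> ('a \<Rightarrow> ('a, 'e) tvec) \<Rightarrow> ('a \<Rightarrow> ('a, 'e) tvec) \<Rightarrow>
     'a \<Rightarrow> ('a, 'e) tvec" where
  "lie_bracket A X Y x =
     (\<lambda>c. if c \<in> charts_at A x
          then frechet_derivative (\<lambda>z. Y (chart_inv c z) c) (at (coord c x)) (X x c)
             - frechet_derivative (\<lambda>z. X (chart_inv c z) c) (at (coord c x)) (Y x c)
          else 0)"

definition integral_curve ::
  "('a, 'e::real_normed_vector) atlas \<Rightarrow> ('a \<Rightarrow> ('a, 'e) tvec) \<Rightarrow> real set \<Rightarrow> (real \<Rightarrow> 'a) \<Rightarrow> bool" where
  "integral_curve A Z I \<gamma> \<longleftrightarrow>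
     smooth_map (open_atlas I) A \<gamma> \<and> (\<forall>t\<in>I. velocity A \<gamma> t = Z (\<gamma> t))"

text \<open>\<open>\<Phi>\<close>, with domain \<open>D\<close>, is the maximal flow of the vector field \<open>Z\<close>.\<close>

definition flow_of ::
  "('a, 'e::real_normed_vector) atlas \<Rightarrow> ('a \<Rightarrow> ('a, 'e) tvec) \<Rightarrow> (real \<times> 'a) set \<Rightarrow>
     (real \<Rightarrow> 'a \<Rightarrow> 'a) \<Rightarrow> bool" where
  "flow_of A Z D \<Phi> \<longleftrightarrow>
     manifold_open (prod_atlas (open_atlas UNIV) A) D \<and>
     smooth_map (restrict_atlas (prod_atlas (open_atlas UNIV) A) D) A (\<lambda>(t, x). \<Phi> t x) \<and>
     (\<forall>x\<in>points A.
        (0, x) \<in> D \<and> is_interval {t. (t, x) \<in> D} \<and> \<Phi> 0 x = x \<and>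
        integral_curve A Z {t. (t, x) \<in> D} (\<lambda>t. \<Phi> t x) \<and>
        (\<forall>I \<gamma>. open_interval I \<and> 0 \<in> I \<and> integral_curve A Z I \<gamma> \<and> \<gamma> 0 = x \<longrightarrow>
           (\<forall>t\<in>I. (t, x) \<in> D \<and> \<gamma> t = \<Phi> t x)))"


section \<open>Lifts to the cotangent bundle and its canonical forms\<close>

text \<open>
  The canonical lift, i.e. the transpose of the tangent map of the inverse, of a diffeomorphism
  \<open>F\<close> from the open set \<open>U\<close> onto an open set. It is applied to local flows, so \<open>U\<close> need not
  be the whole manifold.
\<close>

definition cotangent_lift ::
  "('a, 'e::real_normed_vector) atlas \<Rightarrow> 'a set \<Rightarrow> ('a \<Rightarrow> 'a) \<Rightarrow> ('a, 'e) ctbundle \<Rightarrow>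
     ('a, 'e) ctbundle" where
  "cotangent_lift A U F = (\<lambda>(x, \<alpha>).
     (F x, \<lambda>w. if w \<in> tangent_space A (F x)
               then \<alpha> (tangent_map A A (inv_into U F) (F x) w) else 0))"

text \<open>
  \<open>Zh\<close> is the vector field whose flow is the canonical lift of the flow of \<open>Z\<close>. The maximal flow
  of \<open>Z\<close> exists and is unique, so that the quantifier over \<open>D\<close> and \<open>\<Phi>\<close> only names it.
\<close>

definition canonical_lift ::
  "('a, 'e::real_normed_vector) atlas \<Rightarrow> ('a \<Rightarrow> ('a, 'e) tvec) \<Rightarrow>
     (('a, 'e) ctbundle \<Rightarrow> (('a, 'e) ctbundle, 'e \<times> ('e \<Rightarrow>\<^sub>L real)) tvec) \<Rightarrow> bool" where
  "canonical_lift A Z Zh \<longleftrightarrow>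
     vector_field (cotangent_atlas A) Zh \<and>
     (\<exists>D \<Phi>. flow_of A Z D \<Phi> \<and>
        flow_of (cotangent_atlas A) Zh
          {(t, \<xi>). \<xi> \<in> points (cotangent_atlas A) \<and> (t, fst \<xi>) \<in> D}
          (\<lambda>t. cotangent_lift A {x. (t, x) \<in> D} (\<Phi> t)))"

text \<open>The first projection \<open>fst\<close> is the canonical projection of the cotangent bundle.\<close>

definition liouville ::
  "('a, 'e::real_normed_vector) atlas \<Rightarrow> ('a, 'e) ctbundle \<Rightarrow>
     (('a, 'e) ctbundle, 'e \<times> ('e \<Rightarrow>\<^sub>L real)) covec" where
  "liouville A \<xi> w =
     (if w \<in> tangent_space (cotangent_atlas A) \<xi>
      then snd \<xi> (tangent_map (cotangent_atlas A) A fst \<xi> w) else 0)"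

text \<open>
  The exterior derivative of a one-form, \<open>d\<beta>(X, Y) = X (\<beta> Y) - Y (\<beta> X) - \<beta> [X, Y]\<close>, evaluated on
  the fields with constant coordinates \<open>v c\<close> and \<open>w c\<close> in a chart \<open>c\<close>, whose bracket vanishes. The
  result is independent of \<open>c\<close>.
\<close>

definition ext_deriv ::
  "('a, 'e::real_normed_vector) atlas \<Rightarrow> ('a \<Rightarrow> ('a, 'e) covec) \<Rightarrow>
     'a \<Rightarrow> ('a, 'e) tvec \<Rightarrow> ('a, 'e) tvec \<Rightarrow> real" where
  "ext_deriv A \<beta> x v w =
     (let c = (SOME c. c \<in> charts_at A x);
          b = (\<lambda>u z. \<beta> (chart_inv c z) (tvec_of A (chart_inv c z) c u))
      in frechet_derivative (b (w c)) (at (coord c x)) (v c)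
       - frechet_derivative (b (v c)) (at (coord c x)) (w c))"

definition hamiltonian_vector_field ::
  "('a, 'e::real_normed_vector) atlas \<Rightarrow> (('a, 'e) ctbundle \<Rightarrow> real) \<Rightarrow>
     (('a, 'e) ctbundle \<Rightarrow> (('a, 'e) ctbundle, 'e \<times> ('e \<Rightarrow>\<^sub>L real)) tvec) \<Rightarrow> bool" where
  "hamiltonian_vector_field A H XH \<longleftrightarrow>
     vector_field (cotangent_atlas A) XH \<and>
     (\<forall>\<xi>\<in>points (cotangent_atlas A). \<forall>w\<in>tangent_space (cotangent_atlas A) \<xi>.
        ext_deriv (cotangent_atlas A) (liouville A) \<xi> (XH \<xi>) w
          = - differential (cotangent_atlas A) H \<xi> w)"


section \<open>Hyper-regular Lagrangians\<close>

definition legendre ::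
  "('a, 'e::real_normed_vector) atlas \<Rightarrow> (('a, 'e) tbundle \<Rightarrow> real) \<Rightarrow>
     ('a, 'e) tbundle \<Rightarrow> ('a, 'e) ctbundle" where
  "legendre A L = (\<lambda>(x, v).
     (x, \<lambda>w. if w \<in> tangent_space A x then deriv (\<lambda>s. L (x, \<lambda>c. v c + s *\<^sub>R w c)) 0 else 0))"

definition hyperregular ::
  "('a, 'e::real_normed_vector) atlas \<Rightarrow> (('a, 'e) tbundle \<Rightarrow> real) \<Rightarrow> bool" where
  "hyperregular A L \<longleftrightarrow> diffeomorphism (tangent_atlas A) (cotangent_atlas A) (legendre A L)"

definition comes_from_lagrangian ::
  "('a, 'e::real_normed_vector) atlas \<Rightarrow> (('a, 'e) ctbundle \<Rightarrow> real) \<Rightarrow>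
     (('a, 'e) tbundle \<Rightarrow> real) \<Rightarrow> bool" where
  "comes_from_lagrangian A H L \<longleftrightarrow>
     (\<forall>(x, v)\<in>points (tangent_atlas A).
        H (legendre A L (x, v)) = snd (legendre A L (x, v)) v - L (x, v))"


section \<open>Lie algebra actions and momentum maps\<close>

definition lie_algebra :: "('g::real_normed_vector \<Rightarrow> 'g \<Rightarrow> 'g) \<Rightarrow> bool" where
  "lie_algebra br \<longleftrightarrow>
     finite_dimensional TYPE('g) \<and> bilinear br \<and> (\<forall>X. br X X = 0) \<and>
     (\<forall>X Y Z. br X (br Y Z) + br Y (br Z X) + br Z (br X Y) = 0)"

definition lie_action ::
  "('a, 'e::real_normed_vector) atlas \<Rightarrow> ('g::real_normed_vector \<Rightarrow> 'g \<Rightarrow> 'g) \<Rightarrow>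
     ('g \<Rightarrow> 'a \<Rightarrow> ('a, 'e) tvec) \<Rightarrow> bool" where
  "lie_action A br \<phi> \<longleftrightarrow>
     (\<forall>X. vector_field A (\<phi> X)) \<and>
     (\<forall>x\<in>points A.
        (\<forall>X Y. \<phi> (X + Y) x = (\<lambda>c. \<phi> X x c + \<phi> Y x c)) \<and>
        (\<forall>r X. \<phi> (r *\<^sub>R X) x = (\<lambda>c. r *\<^sub>R \<phi> X x c)) \<and>
        (\<forall>X Y. \<phi> (br X Y) x = lie_bracket A (\<phi> X) (\<phi> Y) x))"

definition locally_transitive ::
  "('a, 'e::real_normed_vector) atlas \<Rightarrow> ('g \<Rightarrow> 'a \<Rightarrow> ('a, 'e) tvec) \<Rightarrow> bool" where
  "locally_transitive A \<phi> \<longleftrightarrow> (\<forall>x\<in>points A. {\<phi> X x |X. True} = tangent_space A x)"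

text \<open>
  The dual of the finite-dimensional Lie algebra \<open>'g\<close> is \<open>'g \<Rightarrow>\<^sub>L real\<close>, since all linear functionals
  on \<open>'g\<close> are bounded.
\<close>

definition ad_star ::
  "('g::real_normed_vector \<Rightarrow> 'g \<Rightarrow> 'g) \<Rightarrow> 'g \<Rightarrow> ('g \<Rightarrow>\<^sub>L real) \<Rightarrow> ('g \<Rightarrow>\<^sub>L real)" where
  "ad_star br X \<zeta> = Blinfun (\<lambda>Y. blinfun_apply \<zeta> (br X Y))"

definition momentum ::
  "('a, 'e::real_normed_vector) atlas \<Rightarrow>
     ('g::real_normed_vector \<Rightarrow> ('a, 'e) ctbundle \<Rightarrow> (('a, 'e) ctbundle, 'e \<times> ('e \<Rightarrow>\<^sub>L real)) tvec) \<Rightarrow>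
     ('a, 'e) ctbundle \<Rightarrow> ('g \<Rightarrow>\<^sub>L real)" where
  "momentum A \<phi>h \<xi> = Blinfun (\<lambda>X. liouville A \<xi> (\<phi>h X \<xi>))"

definition lagrangian_bar ::
  "(('a, 'e) tbundle \<Rightarrow> real) \<Rightarrow> ('g \<Rightarrow> 'a \<Rightarrow> ('a, 'e) tvec) \<Rightarrow> 'a \<Rightarrow> 'g \<Rightarrow> real" where
  "lagrangian_bar L \<phi> x X = L (x, \<phi> X x)"

definition partial_differential1 ::
  "('a, 'e::real_normed_vector) atlas \<Rightarrow> ('a \<Rightarrow> 'g \<Rightarrow> real) \<Rightarrow> 'a \<Rightarrow> 'g \<Rightarrow> ('a, 'e) ctbundle" where
  "partial_differential1 A F x X = (x, differential A (\<lambda>y. F y X) x)"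

end

theory Submission
  imports Defs
begin

text \<open>
  Fix a time \<open>t\<close>, a chart \<open>c\<close> of the manifold around the base point of \<open>\<psi> t\<close>, and write \<open>(q, p)\<close> for
  the coordinates of the curve, \<open>f\<^sub>X\<close> for the coordinate expression of \<open>\<phi> X\<close> and \<open>L(q, u)\<close> for that
  of the Lagrangian. The lift of \<open>\<phi> X\<close> projects to \<open>\<phi> X\<close>, because its flow covers the flow of
  \<open>\<phi> X\<close>; hence \<open>\<langle>J \<circ> \<psi>, X\<rangle> = p (f\<^sub>X q)\<close> (\<open>momentum_apply\<close>), and its derivative is
  \<open>p' (f\<^sub>X q) + p (Df\<^sub>X q')\<close>.

  Since \<open>H\<close> comes from \<open>L\<close>, Hamilton's equations say that \<open>p\<close> is the fibre derivative of \<open>L\<close> at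
  \<open>(q, q')\<close> and that \<open>p' = \<partial>L/\<partial>q (q, q')\<close>. On the other hand \<open>q' = f\<^sub>V q\<close> by the compatibility
  condition, so the chain rule applied to \<open>q \<mapsto> L (q, f\<^sub>V q)\<close> gives
  \<open>\<langle>J (d\<^sub>1 L), X\<rangle> = \<partial>L/\<partial>q (f\<^sub>X q) + p (Df\<^sub>V (f\<^sub>X q)) = p' (f\<^sub>X q) + p (Df\<^sub>V (f\<^sub>X q))\<close>. The difference of
  the two expressions is \<open>p (Df\<^sub>X (f\<^sub>V q) - Df\<^sub>V (f\<^sub>X q))\<close>, that is \<open>p\<close> applied to the bracket
  \<open>[\<phi> V, \<phi> X] = \<phi> [V, X]\<close>, and this is \<open>\<langle>ad\<^sup>*\<^sub>V (J \<circ> \<psi>), X\<rangle>\<close>.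

  The Hamilton equations are obtained without second derivatives of \<open>L\<close>: with \<open>g\<close> the fibre component
  of the inverse Legendre map, \<open>H (q, p) = p (g (q, p)) - L (q, g (q, p))\<close>, and because \<open>p\<close> is the fibre
  derivative of \<open>L\<close> at \<open>(q, g)\<close>, the contributions of the derivative of \<open>g\<close> cancel
  (\<open>differential_of_hamiltonian_in_chart\<close>).

  The differential, the Liouville form and its exterior derivative are defined through an unspecified
  choice of a chart, so part of the work is to evaluate them in a given one. The model spaces are
  normed spaces with a finite spanning set; the little that is used of finite dimension (boundedness
  of linear maps, a basis of the dual) is derived first.
\<close>

section \<open>Finite-dimensional normed spaces\<close>

text \<open>
  The constant is the distance of \<open>x\<close> from the subspace. It controls the coefficient of a newly
  added spanning vector, which is the induction step of the next two lemmas.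
\<close>

lemma coefficient_bound_off_closed_subspace:
  fixes x :: "'v::real_normed_vector"
  assumes "closed S" "subspace S" "x \<notin> S"
  obtains d where "d > 0" "\<And>k m. m \<in> S \<Longrightarrow> \<bar>k\<bar> * d \<le> norm (k *\<^sub>R x + m)"
proof
  have "S \<noteq> {}"
    using assms(2) subspace_0 by blast
  then show "infdist x S > 0"
    using assms(1,3) infdist_pos_not_in_closed by blast
  fix k :: real and m assume m: "m \<in> S"
  show "\<bar>k\<bar> * infdist x S \<le> norm (k *\<^sub>R x + m)"
  proof (cases "k = 0")
    case False
    have "(- 1 / k) *\<^sub>R m \<in> S"
      using assms(2) m subspace_scale by blast
    then have "infdist x S \<le> dist x ((- 1 / k) *\<^sub>R m)"
      by (rule infdist_le)
    also have "\<dots> = norm (x + (1 / k) *\<^sub>R m)"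
      by (simp add: dist_norm)
    finally have "\<bar>k\<bar> * infdist x S \<le> \<bar>k\<bar> * norm (x + (1 / k) *\<^sub>R m)"
      by (simp add: mult_left_mono)
    also have "\<dots> = norm (k *\<^sub>R (x + (1 / k) *\<^sub>R m))"
      by simp
    also have "k *\<^sub>R (x + (1 / k) *\<^sub>R m) = k *\<^sub>R x + m"
      using False by (simp add: scaleR_add_right)
    finally show ?thesis .
  qed simp
qed

text \<open>
  For a Cauchy sequence in the span of \<open>insert x B\<close>, the coefficients of \<open>x\<close> are Cauchy by the
  preceding bound, so the remaining parts form a Cauchy sequence in the span of \<open>B\<close>.
\<close>

lemma complete_span_finite:
  fixes B :: "'v::real_normed_vector set"
  assumes "finite B"
  shows "complete (span B)"
  using assms
proof (induction B rule: finite_induct)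
  case empty
  show ?case by (simp add: complete_eq_closed compact_imp_complete)
next
  case (insert x B)
  show ?case
  proof (cases "x \<in> span B")
    case True
    then show ?thesis
      using insert.IH by (simp add: span_redundant)
  next
    case False
    obtain d where d: "d > 0" "\<And>k m. m \<in> span B \<Longrightarrow> \<bar>k\<bar> * d \<le> norm (k *\<^sub>R x + m)"
      using coefficient_bound_off_closed_subspace[of "span B" x] False
        complete_imp_closed[OF insert.IH] subspace_span by blast
    show ?thesis
      unfolding complete_def
    proof (intro allI impI)
      fix f :: "nat \<Rightarrow> 'v" assume f: "(\<forall>n. f n \<in> span (insert x B)) \<and> Cauchy f"
      then have "\<forall>n. \<exists>k. f n - k *\<^sub>R x \<in> span B"
        by (simp add: span_breakdown_eq)
      then obtain k where k: "\<And>n. f n - k n *\<^sub>R x \<in> span B"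
        by metis
      have step: "\<bar>k m - k n\<bar> * d \<le> norm (f m - f n)" for m n
      proof -
        have "(f m - k m *\<^sub>R x) - (f n - k n *\<^sub>R x) \<in> span B"
          by (intro span_diff k)
        from d(2)[OF this, of "k m - k n"] show ?thesis
          by (simp add: algebra_simps)
      qed
      have "Cauchy k"
      proof (rule CauchyI)
        fix e :: real assume "e > 0"
        then obtain M where M: "\<And>m n. m \<ge> M \<Longrightarrow> n \<ge> M \<Longrightarrow> norm (f m - f n) < e * d"
          using f d(1) CauchyD[of f "e * d"] by (metis mult_pos_pos)
        have "norm (k m - k n) < e" if "m \<ge> M" "n \<ge> M" for m n
        proof -
          have "\<bar>k m - k n\<bar> * d < e * d"
            using step[of m n] M[OF that] by linarith
          then show ?thesis
            using d(1) by simp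
        qed
        then show "\<exists>M. \<forall>m\<ge>M. \<forall>n\<ge>M. norm (k m - k n) < e"
          by blast
      qed
      then obtain a where a: "k \<longlonglongrightarrow> a"
        using Cauchy_convergent convergent_def by blast
      have "Cauchy (\<lambda>n. f n - k n *\<^sub>R x)"
      proof (rule CauchyI)
        fix e :: real assume "e > 0"
        obtain M1 where M1: "\<And>m n. m \<ge> M1 \<Longrightarrow> n \<ge> M1 \<Longrightarrow> norm (f m - f n) < e / 2"
          using f \<open>e > 0\<close> CauchyD[of f "e / 2"] by auto
        have "Cauchy (\<lambda>n. k n *\<^sub>R x)"
          using tendsto_scaleR[OF a tendsto_const] LIMSEQ_imp_Cauchy by blast
        then obtain M2 where
          M2: "\<And>m n. m \<ge> M2 \<Longrightarrow> n \<ge> M2 \<Longrightarrow> norm (k m *\<^sub>R x - k n *\<^sub>R x) < e / 2"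
          using \<open>e > 0\<close> CauchyD[of "\<lambda>n. k n *\<^sub>R x" "e / 2"] by auto
        have "norm ((f m - k m *\<^sub>R x) - (f n - k n *\<^sub>R x)) < e"
          if "m \<ge> max M1 M2" "n \<ge> max M1 M2" for m n
        proof -
          have "(f m - k m *\<^sub>R x) - (f n - k n *\<^sub>R x) = (f m - f n) - (k m *\<^sub>R x - k n *\<^sub>R x)"
            by simp
          then have "norm ((f m - k m *\<^sub>R x) - (f n - k n *\<^sub>R x))
              \<le> norm (f m - f n) + norm (k m *\<^sub>R x - k n *\<^sub>R x)"
            by (metis norm_triangle_ineq4)
          also have "\<dots> < e / 2 + e / 2"
            using M1[of m n] M2[of m n] that by (intro add_strict_mono) auto
          finally show ?thesis by simp
        qed
        then show "\<exists>M. \<forall>m\<ge>M. \<forall>n\<ge>M. norm ((f m - k m *\<^sub>R x) - (f n - k n *\<^sub>R x)) < e"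
          by blast
      qed
      then obtain l where l: "l \<in> span B" "(\<lambda>n. f n - k n *\<^sub>R x) \<longlonglongrightarrow> l"
        using insert.IH k unfolding complete_def
        by (metis (no_types, lifting))
      have "(\<lambda>n. (f n - k n *\<^sub>R x) + k n *\<^sub>R x) \<longlonglongrightarrow> l + a *\<^sub>R x"
        by (intro tendsto_add l tendsto_scaleR a tendsto_const)
      moreover have "l + a *\<^sub>R x \<in> span (insert x B)"
        using l(1) span_breakdown_eq[of "l + a *\<^sub>R x" x B] by (metis add_diff_cancel_right')
      ultimately show "\<exists>l\<in>span (insert x B). f \<longlonglongrightarrow> l"
        by auto
    qed
  qed
qed

lemma linear_bounded_on_span_finite:
  fixes f :: "'v::real_normed_vector \<Rightarrow> 'w::real_normed_vector"
  assumes "finite B" "linear f"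
  shows "\<exists>K. \<forall>v\<in>span B. norm (f v) \<le> norm v * K"
  using assms(1)
proof (induction B rule: finite_induct)
  case empty
  show ?case using linear_0[OF assms(2)] by simp
next
  case (insert x B)
  show ?case
  proof (cases "x \<in> span B")
    case True
    then show ?thesis
      using insert.IH by (simp add: span_redundant)
  next
    case False
    obtain d where d: "d > 0" "\<And>k m. m \<in> span B \<Longrightarrow> \<bar>k\<bar> * d \<le> norm (k *\<^sub>R x + m)"
      using coefficient_bound_off_closed_subspace[of "span B" x] False
        complete_imp_closed[OF complete_span_finite[OF insert.hyps(1)]] subspace_span by blast
    obtain K0 where K0: "\<And>v. v \<in> span B \<Longrightarrow> norm (f v) \<le> norm v * K0"
      using insert.IH by blast
    define K where "K = max K0 0"
    have K: "norm (f v) \<le> norm v * K" if "v \<in> span B" for v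
      using K0[OF that] mult_left_mono[of K0 K "norm v"] by (simp add: K_def)
    have "norm (f v) \<le> norm v * (K + (norm x * K + norm (f x)) / d)" if v: "v \<in> span (insert x B)" for v
    proof -
      obtain k where k: "v - k *\<^sub>R x \<in> span B"
        using v by (auto simp: span_breakdown_eq)
      have kd: "\<bar>k\<bar> \<le> norm v / d"
        using d(2)[OF k, of k] d(1) by (simp add: field_simps)
      have "f v = f (v - k *\<^sub>R x) + k *\<^sub>R f x"
        by (simp add: linear_diff[OF assms(2)] linear_scale[OF assms(2)])
      then have "norm (f v) \<le> norm (f (v - k *\<^sub>R x)) + \<bar>k\<bar> * norm (f x)"
        by (metis norm_scaleR norm_triangle_ineq)
      also have "\<dots> \<le> norm (v - k *\<^sub>R x) * K + \<bar>k\<bar> * norm (f x)"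
        using K[OF k] by simp
      also have "\<dots> \<le> (norm v + \<bar>k\<bar> * norm x) * K + \<bar>k\<bar> * norm (f x)"
        using norm_triangle_ineq4[of v "k *\<^sub>R x"] by (simp add: K_def mult_right_mono)
      also have "\<dots> = norm v * K + \<bar>k\<bar> * (norm x * K + norm (f x))"
        by (simp add: algebra_simps)
      also have "\<dots> \<le> norm v * K + (norm v / d) * (norm x * K + norm (f x))"
        using kd by (intro add_left_mono mult_right_mono) (auto simp: K_def)
      finally show ?thesis
        by (simp add: algebra_simps add_divide_distrib)
    qed
    then show ?thesis by blast
  qed
qed

lemma linear_imp_bounded_linear:
  fixes f :: "'v::real_normed_vector \<Rightarrow> 'w::real_normed_vector"
  assumes "finite_dimensional TYPE('v)" "linear f"
  shows "bounded_linear f"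
proof -
  obtain B :: "'v set" where "finite B" "span B = UNIV"
    using assms(1) by (auto simp: finite_dimensional_def)
  then obtain K where "\<forall>v. norm (f v) \<le> norm v * K"
    using linear_bounded_on_span_finite[OF _ assms(2)] by (metis UNIV_I)
  then show ?thesis
    using assms(2) by (simp add: bounded_linear_def bounded_linear_axioms_def) blast
qed

text \<open>
  The coordinate functionals of a basis are linear, hence bounded. They reduce questions about bounded
  linear maps to finitely many vectors, and show that the dual space separates points.
\<close>

lemma finite_dimensional_basis:
  assumes "finite_dimensional TYPE('v::real_normed_vector)"
  obtains B :: "'v::real_normed_vector set" and \<beta> :: "'v \<Rightarrow> 'v \<Rightarrow>\<^sub>L real"
  where "finite B" "\<And>v. v = (\<Sum>b\<in>B. \<beta> b v *\<^sub>R b)"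
proof -
  obtain S :: "'v set" where S: "finite S" "span S = UNIV"
    using assms by (auto simp: finite_dimensional_def)
  obtain B where B: "B \<subseteq> S" "independent B" "span B = UNIV"
    by (metis S(2) dual_order.eq_iff maximal_independent_subset span_mono span_span top.extremum)
  define \<beta> where "\<beta> b = Blinfun (\<lambda>v. representation B v b)" for b
  have \<beta>: "blinfun_apply (\<beta> b) v = representation B v b" for b v
    unfolding \<beta>_def
    by (subst bounded_linear_Blinfun_apply)
      (auto intro!: linear_imp_bounded_linear assms linearI
        simp: representation_add representation_scale B)
  have fin: "finite B"
    using B(1) S(1) finite_subset by blast
  have "v = (\<Sum>b\<in>B. \<beta> b v *\<^sub>R b)" for v
    using sum_representation_eq[OF B(2), of v B] fin by (simp add: \<beta> B(3))
  with fin that show thesis by blast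
qed

lemma dual_separates_points:
  fixes v w :: "'v::real_normed_vector"
  assumes "finite_dimensional TYPE('v)" "\<And>p :: 'v \<Rightarrow>\<^sub>L real. p v = p w"
  shows "v = w"
proof -
  obtain B :: "'v set" and \<beta> where "\<And>v. v = (\<Sum>b\<in>B. blinfun_apply (\<beta> b) v *\<^sub>R b)"
    using finite_dimensional_basis[OF assms(1)] by metis
  then show ?thesis
    by (metis (no_types, lifting) assms(2) sum.cong)
qed

text \<open>
  A bounded linear map on a finite-dimensional space is a fixed bounded linear function of its values on
  a basis, so convergence of difference quotients at each vector is convergence in norm.
\<close>

lemma has_vector_derivative_blinfun_pointwise:
  fixes f :: "real \<Rightarrow> 'v::real_normed_vector \<Rightarrow>\<^sub>L 'w::real_normed_vector" and D :: "'v \<Rightarrow>\<^sub>L 'w"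
  assumes "finite_dimensional TYPE('v)"
    and "\<And>v. ((\<lambda>s. f s v) has_vector_derivative D v) (at t)"
  shows "(f has_vector_derivative D) (at t)"
proof -
  obtain B :: "'v set" and \<beta> where B: "\<And>v. v = (\<Sum>b\<in>B. blinfun_apply (\<beta> b) v *\<^sub>R b)"
    using finite_dimensional_basis[OF assms(1)] by metis
  define E where "E b w = Blinfun (\<lambda>v. \<beta> b v *\<^sub>R w)" for b and w :: 'w
  have bl: "bounded_linear (\<lambda>v. \<beta> b v *\<^sub>R w)" for b and w :: 'w
    by (rule linear_imp_bounded_linear[OF assms(1)])
      (auto intro!: linearI simp: blinfun.add_right blinfun.scaleR_right scaleR_add_left)
  have E: "blinfun_apply (E b w) v = \<beta> b v *\<^sub>R w" for b w v
    using bl by (simp add: E_def bounded_linear_Blinfun_apply)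
  have decomp: "F = (\<Sum>b\<in>B. E b (F b))" for F :: "'v \<Rightarrow>\<^sub>L 'w"
  proof (rule blinfun_eqI)
    fix v
    have "F v = F (\<Sum>b\<in>B. \<beta> b v *\<^sub>R b)"
      using B[of v] by simp
    then show "F v = (\<Sum>b\<in>B. E b (F b)) v"
      by (simp add: blinfun.sum_left E blinfun.sum_right blinfun.scaleR_right)
  qed
  have "bounded_linear (E b)" for b
  proof (rule bounded_linear_intro)
    show "E b (x + y) = E b x + E b y" for x y
      by (rule blinfun_eqI) (simp add: E blinfun.add_left scaleR_add_right)
    show "E b (r *\<^sub>R x) = r *\<^sub>R E b x" for r x
      by (rule blinfun_eqI) (simp add: E blinfun.scaleR_left)
    show "norm (E b x) \<le> norm x * norm (\<beta> b)" for x
      by (rule norm_blinfun_bound)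
        (use mult_right_mono[OF norm_blinfun[of "\<beta> b"] norm_ge_zero[of x]] in
          \<open>auto simp: E mult_ac\<close>)
  qed
  then have "((\<lambda>s. E b (f s b)) has_vector_derivative E b (D b)) (at t)" for b
    using bounded_linear.has_vector_derivative assms(2) by blast
  then have "((\<lambda>s. \<Sum>b\<in>B. E b (f s b)) has_vector_derivative (\<Sum>b\<in>B. E b (D b))) (at t)"
    by (intro has_vector_derivative_sum)
  then show ?thesis
    using decomp by simp
qed

section \<open>Atlases with differentiable transition maps\<close>

lemma smooth_on_imp_differentiable:
  assumes "smooth_on S f" "x \<in> S"
  shows "f differentiable (at x)"
  using assms(1)[unfolded smooth_on_def, rule_format, of "Suc 0"] assms(2) by simp

lemma charts_at_iff: "c \<in> charts_at A x \<longleftrightarrow> c \<in> A \<and> x \<in> cdom c"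
  by (auto simp: charts_at_def)

lemma points_iff_charts_at: "x \<in> points A \<longleftrightarrow> (\<exists>c. c \<in> charts_at A x)"
  by (auto simp: points_def charts_at_def)

lemma charts_at_imp_points: "c \<in> charts_at A x \<Longrightarrow> x \<in> points A"
  by (auto simp: points_iff_charts_at)

lemma some_chart_at:
  assumes "x \<in> points A"
  shows "(SOME c. c \<in> charts_at A x) \<in> charts_at A x"
  using assms some_in_eq by (auto simp: points_iff_charts_at)

lemma chart_inv_coord:
  assumes "inj_on (coord c) (cdom c)" "x \<in> cdom c"
  shows "chart_inv c (coord c x) = x"
  using assms by (simp add: chart_inv_def)

text \<open>
  Tangent vectors and their chain rule need no more than this. The weak notion pays off for the
  cotangent bundle, where it is available without computing the transition maps.
\<close>

definition differentiable_atlas :: "('a, 'e::real_normed_vector) atlas \<Rightarrow> bool" where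
  "differentiable_atlas A \<longleftrightarrow>
     (\<forall>c\<in>A. inj_on (coord c) (cdom c)) \<and>
     (\<forall>c\<in>A. \<forall>d\<in>A. open (coord c ` (cdom c \<inter> cdom d)) \<and>
        (\<forall>x\<in>cdom c \<inter> cdom d. (coord d \<circ> chart_inv c) differentiable (at (coord c x))))"

lemma smooth_atlas_imp_differentiable_atlas:
  assumes "smooth_atlas A"
  shows "differentiable_atlas A"
  using assms unfolding smooth_atlas_def differentiable_atlas_def
  by (blast intro: smooth_on_imp_differentiable)

lemma smooth_map_imp_differentiable:
  assumes "smooth_map A B f" "c \<in> charts_at A x" "d \<in> charts_at B (f x)"
  shows "(coord d \<circ> f \<circ> chart_inv c) differentiable (at (coord c x))"
proof (rule smooth_on_imp_differentiable)
  show "smooth_on (coord c ` (cdom c \<inter> f -` cdom d)) (coord d \<circ> f \<circ> chart_inv c)"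
    using assms by (simp add: smooth_map_def charts_at_iff)
  show "coord c x \<in> coord c ` (cdom c \<inter> f -` cdom d)"
    using assms by (simp add: charts_at_iff)
qed

lemma cdom_tangent_chart:
  "(x, v) \<in> cdom (tangent_chart A c) \<longleftrightarrow> x \<in> cdom c \<and> v \<in> tangent_space A x"
  by (simp add: tangent_chart_def)

lemma coord_tangent_chart: "coord (tangent_chart A c) (x, v) = (coord c x, v c)"
  by (simp add: tangent_chart_def)

lemma charts_at_tangent_atlas:
  "C \<in> charts_at (tangent_atlas A) (x, v) \<longleftrightarrow>
     v \<in> tangent_space A x \<and> (\<exists>c\<in>charts_at A x. C = tangent_chart A c)"
  by (auto simp: charts_at_iff tangent_atlas_def cdom_tangent_chart)

lemma points_tangent_atlas:
  "(x, v) \<in> points (tangent_atlas A) \<longleftrightarrow> x \<in> points A \<and> v \<in> tangent_space A x"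
  by (auto simp: points_iff_charts_at charts_at_tangent_atlas)

lemma vector_field_in_tangent_space:
  assumes "vector_field A Z" "x \<in> points A"
  shows "Z x \<in> tangent_space A x"
proof -
  have "(x, Z x) \<in> points (tangent_atlas A)"
    using assms by (auto simp: vector_field_def smooth_map_def)
  then show ?thesis by (simp add: points_tangent_atlas)
qed

lemma vector_field_differentiable:
  assumes "vector_field A Z" "c \<in> charts_at A x"
  shows "(\<lambda>z. Z (chart_inv c z) c) differentiable (at (coord c x))"
proof -
  have x: "x \<in> points A"
    using assms(2) by (auto simp: points_iff_charts_at)
  have "tangent_chart A c \<in> charts_at (tangent_atlas A) (x, Z x)"
    using assms vector_field_in_tangent_space[OF assms(1) x] by (auto simp: charts_at_tangent_atlas)
  with assms have "(coord (tangent_chart A c) \<circ> (\<lambda>x. (x, Z x)) \<circ> chart_inv c) differentiable (at (coord c x))"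
    unfolding vector_field_def by (rule smooth_map_imp_differentiable)
  then have "(\<lambda>z. snd ((coord (tangent_chart A c) \<circ> (\<lambda>x. (x, Z x)) \<circ> chart_inv c) z)) differentiable (at (coord c x))"
    unfolding differentiable_def using has_derivative_snd by blast
  then show ?thesis
    by (simp add: o_def coord_tangent_chart)
qed

text \<open>
  The coordinates of the section \<open>x \<mapsto> (x, Z x)\<close> of the tangent bundle, read in two charts, have the
  transition map of the charts as their first component. Smoothness of the section therefore already contains
  differentiability of the transition maps. Applied to a Hamiltonian vector field, this makes the
  cotangent atlas differentiable without differentiating transposed inverse Jacobians.
\<close>

lemma vector_field_imp_differentiable_atlas:
  assumes "vector_field A Z" "\<And>c. c \<in> A \<Longrightarrow> inj_on (coord c) (cdom c)"
  shows "differentiable_atlas A"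
  unfolding differentiable_atlas_def
proof (intro conjI ballI)
  fix c d assume cd: "c \<in> A" "d \<in> A"
  have "Z x \<in> tangent_space A x" if "x \<in> cdom c" for x
    using vector_field_in_tangent_space[OF assms(1)] that cd by (auto simp: points_def)
  then have eq: "cdom c \<inter> (\<lambda>x. (x, Z x)) -` cdom (tangent_chart A d) = cdom c \<inter> cdom d"
    by (auto simp: cdom_tangent_chart)
  have "tangent_chart A d \<in> tangent_atlas A"
    using cd by (simp add: tangent_atlas_def)
  with assms(1) cd(1) have *: "open (coord c ` (cdom c \<inter> cdom d))"
      "smooth_on (coord c ` (cdom c \<inter> cdom d)) (coord (tangent_chart A d) \<circ> (\<lambda>x. (x, Z x)) \<circ> chart_inv c)"
    unfolding vector_field_def smooth_map_def eq[symmetric] by blast+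
  show "open (coord c ` (cdom c \<inter> cdom d))"
    by (rule *)
  fix x assume "x \<in> cdom c \<inter> cdom d"
  with *(2) have "(coord (tangent_chart A d) \<circ> (\<lambda>x. (x, Z x)) \<circ> chart_inv c) differentiable (at (coord c x))"
    by (blast intro: smooth_on_imp_differentiable)
  then have "(\<lambda>z. fst ((coord (tangent_chart A d) \<circ> (\<lambda>x. (x, Z x)) \<circ> chart_inv c) z)) differentiable (at (coord c x))"
    unfolding differentiable_def using has_derivative_fst by blast
  then show "(coord d \<circ> chart_inv c) differentiable (at (coord c x))"
    by (simp add: o_def coord_tangent_chart)
qed (rule assms(2))

abbreviation transition_derivative ::
  "('a, 'e::real_normed_vector) chart \<Rightarrow> ('a, 'e) chart \<Rightarrow> 'a \<Rightarrow> 'e \<Rightarrow> 'e" where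
  "transition_derivative c d x \<equiv> frechet_derivative (coord d \<circ> chart_inv c) (at (coord c x))"

lemma differentiable_atlas_inj:
  "differentiable_atlas A \<Longrightarrow> c \<in> charts_at A x \<Longrightarrow> inj_on (coord c) (cdom c)"
  by (auto simp: differentiable_atlas_def charts_at_iff)

lemma chart_inv_coord_at:
  "differentiable_atlas A \<Longrightarrow> c \<in> charts_at A x \<Longrightarrow> y \<in> cdom c \<Longrightarrow> chart_inv c (coord c y) = y"
  by (metis chart_inv_coord differentiable_atlas_inj)

lemma chart_overlap_open:
  assumes "differentiable_atlas A" "c \<in> charts_at A x" "d \<in> charts_at A x"
  shows "open (coord c ` (cdom c \<inter> cdom d))" "coord c x \<in> coord c ` (cdom c \<inter> cdom d)"
  using assms by (auto simp: differentiable_atlas_def charts_at_iff)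

lemma chart_image_open:
  assumes "differentiable_atlas A" "c \<in> charts_at A x"
  shows "open (coord c ` cdom c)" "coord c x \<in> coord c ` cdom c"
  using chart_overlap_open[OF assms assms(2)] by auto

lemma transition_has_derivative:
  assumes "differentiable_atlas A" "c \<in> charts_at A x" "d \<in> charts_at A x"
  shows "(coord d \<circ> chart_inv c has_derivative transition_derivative c d x) (at (coord c x))"
  using assms frechet_derivative_works[of "coord d \<circ> chart_inv c" "at (coord c x)"]
  by (auto simp: differentiable_atlas_def charts_at_iff)

lemma transition_derivative_linear:
  assumes "differentiable_atlas A" "c \<in> charts_at A x" "d \<in> charts_at A x"
  shows "bounded_linear (transition_derivative c d x)"
  using transition_has_derivative[OF assms] has_derivative_bounded_linear by blast

lemma transition_derivative_compose:
  assumes A: "differentiable_atlas A"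
    and b: "b \<in> charts_at A x" and c: "c \<in> charts_at A x" and d: "d \<in> charts_at A x"
  shows "transition_derivative c d x (transition_derivative b c x u) = transition_derivative b d x u"
proof -
  have eq: "chart_inv b (coord b x) = x"
    using chart_inv_coord_at[OF A b] b by (simp add: charts_at_iff)
  have "((coord d \<circ> chart_inv c) \<circ> (coord c \<circ> chart_inv b) has_derivative
      transition_derivative c d x \<circ> transition_derivative b c x) (at (coord b x))"
    using transition_has_derivative[OF A b c] transition_has_derivative[OF A c d]
    by (intro diff_chain_at) (simp_all add: eq)
  then have "(coord d \<circ> chart_inv b has_derivative
      transition_derivative c d x \<circ> transition_derivative b c x) (at (coord b x))"
    by (rule has_derivative_transform_within_open[OF _ chart_overlap_open[OF A b c]])
      (use A b c in \<open>auto simp: chart_inv_coord_at\<close>)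
  then have "transition_derivative c d x \<circ> transition_derivative b c x = transition_derivative b d x"
    by (rule frechet_derivative_at)
  then show ?thesis
    by (metis comp_apply)
qed

lemma transition_derivative_self:
  assumes A: "differentiable_atlas A" and c: "c \<in> charts_at A x"
  shows "transition_derivative c c x u = u"
proof -
  have "(coord c \<circ> chart_inv c has_derivative (\<lambda>u. u)) (at (coord c x))"
    by (rule has_derivative_transform_within_open[OF has_derivative_ident chart_image_open[OF A c]])
      (use A c in \<open>auto simp: chart_inv_coord_at\<close>)
  from frechet_derivative_at[OF this] show ?thesis by metis
qed

lemma tangent_vector_change_chart:
  assumes "v \<in> tangent_space A x" "c \<in> charts_at A x" "d \<in> charts_at A x"
  shows "v d = transition_derivative c d x (v c)"
  using assms unfolding tangent_space_def by blast

lemma tangent_vector_outside: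
  assumes "v \<in> tangent_space A x" "d \<notin> charts_at A x"
  shows "v d = 0"
  using assms unfolding tangent_space_def by blast

lemma tvec_of_in_tangent_space:
  assumes "differentiable_atlas A" "c \<in> charts_at A x"
  shows "tvec_of A x c u \<in> tangent_space A x"
  using assms by (auto simp: tangent_space_def tvec_of_def transition_derivative_compose)

lemma tvec_of_apply_self:
  assumes "differentiable_atlas A" "c \<in> charts_at A x"
  shows "tvec_of A x c u c = u"
  using assms by (simp add: tvec_of_def transition_derivative_self)

lemma tvec_of_tangent_vector:
  assumes "v \<in> tangent_space A x" "c \<in> charts_at A x"
  shows "tvec_of A x c (v c) = v"
proof
  fix d
  show "tvec_of A x c (v c) d = v d"
    using tangent_vector_change_chart[OF assms, of d] tangent_vector_outside[OF assms(1), of d]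
    by (simp add: tvec_of_def)
qed

lemma tvec_of_add:
  assumes "differentiable_atlas A" "c \<in> charts_at A x"
  shows "tvec_of A x c (u + w) = (\<lambda>d. tvec_of A x c u d + tvec_of A x c w d)"
  using transition_derivative_linear[OF assms]
  by (auto simp: tvec_of_def fun_eq_iff bounded_linear.linear linear_add)

lemma tvec_of_scaleR:
  assumes "differentiable_atlas A" "c \<in> charts_at A x"
  shows "tvec_of A x c (r *\<^sub>R u) = (\<lambda>d. r *\<^sub>R tvec_of A x c u d)"
  using transition_derivative_linear[OF assms]
  by (auto simp: tvec_of_def fun_eq_iff bounded_linear.linear linear_scale)

lemma tvec_of_change_chart:
  assumes "differentiable_atlas A" "b \<in> charts_at A x" "c \<in> charts_at A x"
  shows "tvec_of A x c (transition_derivative b c x u) = tvec_of A x b u"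
  using assms by (auto simp: tvec_of_def transition_derivative_compose)

lemma tangent_space_add:
  assumes "differentiable_atlas A" "v \<in> tangent_space A x" "w \<in> tangent_space A x"
  shows "(\<lambda>c. v c + w c) \<in> tangent_space A x"
  using assms
proof (cases "\<exists>c. c \<in> charts_at A x")
  case True
  then obtain c where c: "c \<in> charts_at A x" by blast
  have "(\<lambda>c. v c + w c) = tvec_of A x c (v c + w c)"
    using assms c by (simp add: tvec_of_add tvec_of_tangent_vector)
  then show ?thesis
    using assms(1) c tvec_of_in_tangent_space by metis
qed (auto simp: tangent_space_def)

lemma tangent_space_scaleR:
  assumes "differentiable_atlas A" "v \<in> tangent_space A x"
  shows "(\<lambda>c. r *\<^sub>R v c) \<in> tangent_space A x"
  using assms
proof (cases "\<exists>c. c \<in> charts_at A x")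
  case True
  then obtain c where c: "c \<in> charts_at A x" by blast
  have "(\<lambda>c. r *\<^sub>R v c) = tvec_of A x c (r *\<^sub>R v c)"
    using assms c by (simp add: tvec_of_scaleR tvec_of_tangent_vector)
  then show ?thesis
    using assms(1) c tvec_of_in_tangent_space by metis
qed (auto simp: tangent_space_def)

text \<open>
  By the chain rule for the transition map, the chart that was chosen in the definition of the
  differential may be replaced by any other.
\<close>

lemma differential_in_chart:
  assumes A: "differentiable_atlas A" and c: "c \<in> charts_at A x" and v: "v \<in> tangent_space A x"
    and f: "(f \<circ> chart_inv c has_derivative f') (at (coord c x))"
  shows "differential A f x v = f' (v c)"
proof -
  define b where "b = (SOME c. c \<in> charts_at A x)"
  have b: "b \<in> charts_at A x"
    unfolding b_def using c by (metis someI)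
  have eq: "chart_inv b (coord b x) = x"
    using chart_inv_coord_at[OF A b] b by (simp add: charts_at_iff)
  have "((f \<circ> chart_inv c) \<circ> (coord c \<circ> chart_inv b) has_derivative
      f' \<circ> transition_derivative b c x) (at (coord b x))"
    using transition_has_derivative[OF A b c] f by (intro diff_chain_at) (simp_all add: eq)
  then have "(f \<circ> chart_inv b has_derivative f' \<circ> transition_derivative b c x) (at (coord b x))"
    by (rule has_derivative_transform_within_open[OF _ chart_overlap_open[OF A b c]])
      (use A b c in \<open>auto simp: chart_inv_coord_at\<close>)
  then have "f' \<circ> transition_derivative b c x = frechet_derivative (f \<circ> chart_inv b) (at (coord b x))"
    by (rule frechet_derivative_at)
  moreover have "transition_derivative b c x (v b) = v c"
    using tangent_vector_change_chart[OF v b c] by simp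
  ultimately show ?thesis
    using v by (simp add: differential_def Let_def flip: b_def) (metis comp_apply)
qed

lemma differential_in_cotangent_space:
  assumes A: "differentiable_atlas A" and c: "c \<in> charts_at A x"
    and f: "(f \<circ> chart_inv c has_derivative f') (at (coord c x))"
  shows "differential A f x \<in> cotangent_space A x"
proof -
  have l: "linear f'"
    using f has_derivative_linear by blast
  have "differential A f x v = 0" if "v \<notin> tangent_space A x" for v
    using that by (simp add: differential_def Let_def)
  then show ?thesis
    using l unfolding cotangent_space_def
    by (simp add: differential_in_chart[OF A c _ f] tangent_space_add[OF A] tangent_space_scaleR[OF A]
        linear_add linear_scale)
qed

lemma smooth_curve_in_chart:
  assumes "smooth_map (open_atlas I) A \<gamma>" "t \<in> I" "c \<in> charts_at A (\<gamma> t)"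
  shows "(coord c \<circ> \<gamma>) differentiable (at t)"
    and "\<exists>S. open S \<and> t \<in> S \<and> S \<subseteq> I \<and> (\<forall>s\<in>S. \<gamma> s \<in> cdom c)"
proof -
  let ?S = "I \<inter> \<gamma> -` cdom c"
  have id: "chart_inv (Chart I id) s = s" if "s \<in> I" for s
    using that inv_into_f_f[of id I s] by (simp add: chart_inv_def)
  have S: "open ?S"
    using assms by (auto simp: smooth_map_def open_atlas_def charts_at_iff)
  moreover have t: "t \<in> ?S"
    using assms by (simp add: charts_at_iff)
  ultimately show "\<exists>S. open S \<and> t \<in> S \<and> S \<subseteq> I \<and> (\<forall>s\<in>S. \<gamma> s \<in> cdom c)"
    by (intro exI[of _ ?S]) auto
  have "Chart I id \<in> charts_at (open_atlas I) t"
    using assms(2) by (simp add: charts_at_iff open_atlas_def)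
  from smooth_map_imp_differentiable[OF assms(1) this assms(3)]
  have "(coord c \<circ> \<gamma> \<circ> chart_inv (Chart I id)) differentiable (at t)"
    by simp
  then obtain D where "(coord c \<circ> \<gamma> \<circ> chart_inv (Chart I id) has_derivative D) (at t)"
    by (auto simp: differentiable_def)
  then have "(coord c \<circ> \<gamma> has_derivative D) (at t)"
    by (rule has_derivative_transform_within_open[OF _ S t]) (simp add: id)
  then show "(coord c \<circ> \<gamma>) differentiable (at t)"
    by (auto simp: differentiable_def)
qed

section \<open>Coordinates on the cotangent bundle\<close>

text \<open>
  The fibre coordinate \<open>p\<close> of a covector in the chart of the cotangent bundle induced by \<open>c\<close>.
\<close>

definition covec_coord ::
  "('a, 'e::real_normed_vector) atlas \<Rightarrow> ('a, 'e) chart \<Rightarrow> 'a \<Rightarrow> ('a, 'e) covec \<Rightarrow> 'e \<Rightarrow>\<^sub>L real" where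
  "covec_coord A c x \<alpha> = Blinfun (\<lambda>u. \<alpha> (tvec_of A x c u))"

lemma covec_coord_apply:
  fixes A :: "('a, 'e::real_normed_vector) atlas"
  assumes fd: "finite_dimensional TYPE('e)" and A: "differentiable_atlas A"
    and c: "c \<in> charts_at A x" and \<alpha>: "\<alpha> \<in> cotangent_space A x"
  shows "blinfun_apply (covec_coord A c x \<alpha>) u = \<alpha> (tvec_of A x c u)"
proof -
  have "linear (\<lambda>u. \<alpha> (tvec_of A x c u))"
    using \<alpha> tvec_of_in_tangent_space[OF A c]
    by (intro linearI) (auto simp: tvec_of_add[OF A c] tvec_of_scaleR[OF A c] cotangent_space_def)
  then show ?thesis
    unfolding covec_coord_def by (simp add: bounded_linear_Blinfun_apply linear_imp_bounded_linear[OF fd])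
qed

lemma covec_apply_in_chart:
  fixes A :: "('a, 'e::real_normed_vector) atlas"
  assumes "finite_dimensional TYPE('e)" "differentiable_atlas A"
    and "c \<in> charts_at A x" "\<alpha> \<in> cotangent_space A x" "w \<in> tangent_space A x"
  shows "\<alpha> w = blinfun_apply (covec_coord A c x \<alpha>) (w c)"
  using assms by (simp add: covec_coord_apply tvec_of_tangent_vector)

lemma covec_coord_inject:
  fixes A :: "('a, 'e::real_normed_vector) atlas"
  assumes "finite_dimensional TYPE('e)" "differentiable_atlas A" "c \<in> charts_at A x"
    and "\<alpha> \<in> cotangent_space A x" "\<beta> \<in> cotangent_space A x"
    and "covec_coord A c x \<alpha> = covec_coord A c x \<beta>"
  shows "\<alpha> = \<beta>"
proof
  fix w
  show "\<alpha> w = \<beta> w"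
  proof (cases "w \<in> tangent_space A x")
    case True
    then show ?thesis
      using assms covec_apply_in_chart[OF assms(1-3)] by metis
  next
    case False
    then show ?thesis
      using assms(4,5) by (simp add: cotangent_space_def)
  qed
qed

lemma cdom_cotangent_chart:
  "\<xi> \<in> cdom (cotangent_chart A c) \<longleftrightarrow> fst \<xi> \<in> cdom c \<and> snd \<xi> \<in> cotangent_space A (fst \<xi>)"
  by (auto simp: cotangent_chart_def)

lemma coord_cotangent_chart:
  "coord (cotangent_chart A c) \<xi> = (coord c (fst \<xi>), covec_coord A c (fst \<xi>) (snd \<xi>))"
  by (simp add: cotangent_chart_def covec_coord_def split_beta)

lemma charts_at_cotangent_atlas:
  "C \<in> charts_at (cotangent_atlas A) \<xi> \<longleftrightarrow>
     snd \<xi> \<in> cotangent_space A (fst \<xi>) \<and> (\<exists>c\<in>charts_at A (fst \<xi>). C = cotangent_chart A c)"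
  by (auto simp: charts_at_iff cotangent_atlas_def cdom_cotangent_chart)

lemma points_cotangent_atlas:
  "\<xi> \<in> points (cotangent_atlas A) \<longleftrightarrow> fst \<xi> \<in> points A \<and> snd \<xi> \<in> cotangent_space A (fst \<xi>)"
  by (auto simp: points_iff_charts_at charts_at_cotangent_atlas)

lemma inj_on_tangent_chart:
  assumes A: "differentiable_atlas A" and c: "c \<in> A"
  shows "inj_on (coord (tangent_chart A c)) (cdom (tangent_chart A c))"
proof (intro inj_onI, clarsimp simp: cdom_tangent_chart coord_tangent_chart)
  fix x v y w
  assume *: "x \<in> cdom c" "v \<in> tangent_space A x" "y \<in> cdom c" "w \<in> tangent_space A y"
    "coord c x = coord c y" "v c = w c"
  then have "x = y"
    using A c by (auto simp: differentiable_atlas_def inj_on_def)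
  moreover have "tvec_of A x c (v c) = v"
    by (rule tvec_of_tangent_vector) (use * c in \<open>simp_all add: charts_at_iff\<close>)
  moreover have "tvec_of A y c (w c) = w"
    by (rule tvec_of_tangent_vector) (use * c in \<open>simp_all add: charts_at_iff\<close>)
  ultimately show "x = y \<and> v = w"
    using *(6) by metis
qed

lemma chart_inv_tangent_chart:
  assumes A: "differentiable_atlas A" and c: "c \<in> charts_at A x" and v: "v \<in> tangent_space A x"
  shows "chart_inv (tangent_chart A c) (coord c x, v c) = (x, v)"
proof -
  have "inj_on (coord (tangent_chart A c)) (cdom (tangent_chart A c))"
    using c by (intro inj_on_tangent_chart A) (simp add: charts_at_iff)
  moreover have "(x, v) \<in> cdom (tangent_chart A c)"
    using c v by (simp add: cdom_tangent_chart charts_at_iff)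
  ultimately have "chart_inv (tangent_chart A c) (coord (tangent_chart A c) (x, v)) = (x, v)"
    by (rule chart_inv_coord)
  then show ?thesis
    by (simp add: coord_tangent_chart)
qed

lemma inj_on_cotangent_chart:
  fixes A :: "('a, 'e::real_normed_vector) atlas"
  assumes "finite_dimensional TYPE('e)" and A: "differentiable_atlas A" and c: "c \<in> A"
  shows "inj_on (coord (cotangent_chart A c)) (cdom (cotangent_chart A c))"
proof (rule inj_onI)
  fix \<xi> \<eta>
  assume *: "\<xi> \<in> cdom (cotangent_chart A c)" "\<eta> \<in> cdom (cotangent_chart A c)"
    "coord (cotangent_chart A c) \<xi> = coord (cotangent_chart A c) \<eta>"
  then have "fst \<xi> = fst \<eta>"
    using A c by (auto simp: differentiable_atlas_def inj_on_def cdom_cotangent_chart coord_cotangent_chart)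
  moreover have "snd \<xi> = snd \<eta>"
    using * c \<open>fst \<xi> = fst \<eta>\<close>
    by (intro covec_coord_inject[OF assms(1) A, of c "fst \<xi>"])
      (simp_all add: cdom_cotangent_chart coord_cotangent_chart charts_at_iff)
  ultimately show "\<xi> = \<eta>"
    by (simp add: prod_eq_iff)
qed

lemma vector_field_imp_differentiable_cotangent_atlas:
  fixes A :: "('a, 'e::real_normed_vector) atlas"
  assumes "finite_dimensional TYPE('e)" "differentiable_atlas A" "vector_field (cotangent_atlas A) Z"
  shows "differentiable_atlas (cotangent_atlas A)"
  by (rule vector_field_imp_differentiable_atlas[OF assms(3)])
    (use assms in \<open>auto simp: cotangent_atlas_def inj_on_cotangent_chart\<close>)

lemma projection_has_derivative:
  assumes A: "differentiable_atlas A" and B: "differentiable_atlas (cotangent_atlas A)"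
    and e: "e \<in> charts_at A (fst \<xi>)" and d: "d \<in> charts_at A (fst \<xi>)"
    and \<xi>: "snd \<xi> \<in> cotangent_space A (fst \<xi>)"
  shows "(coord d \<circ> fst \<circ> chart_inv (cotangent_chart A e) has_derivative
           (\<lambda>h. transition_derivative e d (fst \<xi>) (fst h))) (at (coord (cotangent_chart A e) \<xi>))"
proof -
  let ?E = "cotangent_chart A e"
  have E: "?E \<in> charts_at (cotangent_atlas A) \<xi>"
    using e \<xi> by (auto simp: charts_at_cotangent_atlas)
  have "((coord d \<circ> chart_inv e) \<circ> fst has_derivative transition_derivative e d (fst \<xi>) \<circ> fst)
      (at (coord ?E \<xi>))"
    by (rule diff_chain_at)
      (use transition_has_derivative[OF A e d] in \<open>auto intro!: derivative_eq_intros simp: coord_cotangent_chart\<close>)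
  then have "(coord d \<circ> fst \<circ> chart_inv ?E has_derivative transition_derivative e d (fst \<xi>) \<circ> fst)
      (at (coord ?E \<xi>))"
  proof (rule has_derivative_transform_within_open[OF _ chart_image_open[OF B E]])
    fix \<zeta> assume "\<zeta> \<in> coord ?E ` cdom ?E"
    then obtain \<eta> where \<eta>: "\<eta> \<in> cdom ?E" "\<zeta> = coord ?E \<eta>"
      by blast
    moreover have "chart_inv e (coord e (fst \<eta>)) = fst \<eta>"
      using \<eta> A e by (simp add: chart_inv_coord_at cdom_cotangent_chart)
    ultimately show "(coord d \<circ> chart_inv e \<circ> fst) \<zeta> = (coord d \<circ> fst \<circ> chart_inv ?E) \<zeta>"
      using B E by (simp add: chart_inv_coord_at) (simp add: coord_cotangent_chart)
  qed
  then show ?thesis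
    by (simp add: o_def)
qed

text \<open>
  In coordinates a transition map of the cotangent bundle covers the transition map of the base, so
  the base parts of the representatives of a tangent vector are again related by the base transition.
\<close>

lemma tangent_vector_projection_change_chart:
  assumes A: "differentiable_atlas A" and B: "differentiable_atlas (cotangent_atlas A)"
    and e: "e \<in> charts_at A (fst \<xi>)" and c: "c \<in> charts_at A (fst \<xi>)"
    and w: "w \<in> tangent_space (cotangent_atlas A) \<xi>" and \<xi>: "snd \<xi> \<in> cotangent_space A (fst \<xi>)"
  shows "fst (w (cotangent_chart A c))
           = transition_derivative e c (fst \<xi>) (fst (w (cotangent_chart A e)))"
proof -
  let ?E = "cotangent_chart A e" and ?C = "cotangent_chart A c"
  have E: "?E \<in> charts_at (cotangent_atlas A) \<xi>" and C: "?C \<in> charts_at (cotangent_atlas A) \<xi>"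
    using e c \<xi> by (auto simp: charts_at_cotangent_atlas)
  have "((\<lambda>\<zeta>. fst ((coord ?C \<circ> chart_inv ?E) \<zeta>)) has_derivative
      (\<lambda>h. fst (transition_derivative ?E ?C \<xi> h))) (at (coord ?E \<xi>))"
    by (rule has_derivative_fst[OF transition_has_derivative[OF B E C]])
  also have "(\<lambda>\<zeta>. fst ((coord ?C \<circ> chart_inv ?E) \<zeta>)) = coord c \<circ> fst \<circ> chart_inv ?E"
    by (simp add: fun_eq_iff coord_cotangent_chart)
  finally have "(\<lambda>h. fst (transition_derivative ?E ?C \<xi> h))
      = (\<lambda>h. transition_derivative e c (fst \<xi>) (fst h))"
    using projection_has_derivative[OF A B e c \<xi>] has_derivative_unique by blast
  moreover have "w ?C = transition_derivative ?E ?C \<xi> (w ?E)"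
    by (rule tangent_vector_change_chart[OF w E C])
  ultimately show ?thesis
    by metis
qed

lemma tangent_map_projection:
  assumes A: "differentiable_atlas A" and B: "differentiable_atlas (cotangent_atlas A)"
    and c: "c \<in> charts_at A (fst \<xi>)"
    and w: "w \<in> tangent_space (cotangent_atlas A) \<xi>" and \<xi>: "snd \<xi> \<in> cotangent_space A (fst \<xi>)"
  shows "tangent_map (cotangent_atlas A) A fst \<xi> w
           = tvec_of A (fst \<xi>) c (fst (w (cotangent_chart A c)))"
proof -
  have "\<xi> \<in> points (cotangent_atlas A)"
    using \<xi> charts_at_imp_points[OF c] by (simp add: points_cotangent_atlas)
  from some_chart_at[OF this] obtain e where e: "e \<in> charts_at A (fst \<xi>)"
    and E: "(SOME C. C \<in> charts_at (cotangent_atlas A) \<xi>) = cotangent_chart A e"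
    by (auto simp: charts_at_cotangent_atlas)
  have "tangent_map (cotangent_atlas A) A fst \<xi> w = tvec_of A (fst \<xi>) e (fst (w (cotangent_chart A e)))"
  proof
    fix d
    show "tangent_map (cotangent_atlas A) A fst \<xi> w d
        = tvec_of A (fst \<xi>) e (fst (w (cotangent_chart A e))) d"
      using fun_cong[OF frechet_derivative_at[OF projection_has_derivative[OF A B e _ \<xi>, of d]],
          of "w (cotangent_chart A e)"]
      by (simp add: tangent_map_def E Let_def tvec_of_def)
  qed
  also have "\<dots> = tvec_of A (fst \<xi>) c (fst (w (cotangent_chart A c)))"
    by (simp add: tangent_vector_projection_change_chart[OF A B e c w \<xi>] tvec_of_change_chart[OF A e c])
  finally show ?thesis .
qed

lemma liouville_in_chart:
  fixes A :: "('a, 'e::real_normed_vector) atlas"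
  assumes fd: "finite_dimensional TYPE('e)"
    and A: "differentiable_atlas A" and B: "differentiable_atlas (cotangent_atlas A)"
    and c: "c \<in> charts_at A (fst \<xi>)"
    and w: "w \<in> tangent_space (cotangent_atlas A) \<xi>" and \<xi>: "snd \<xi> \<in> cotangent_space A (fst \<xi>)"
  shows "liouville A \<xi> w
     = blinfun_apply (snd (coord (cotangent_chart A c) \<xi>)) (fst (w (cotangent_chart A c)))"
  using w by (simp add: liouville_def tangent_map_projection[OF A B c w \<xi>]
      coord_cotangent_chart covec_coord_apply[OF fd A c \<xi>])

text \<open>
  In coordinates the form is \<open>\<Sum>p\<^sub>i dx\<^sup>i\<close>, which on a constant field \<open>u\<close> is the linear function
  \<open>(q, p) \<mapsto> p (fst u)\<close>; its derivatives give \<open>\<Sum>dp\<^sub>i \<and> dx\<^sup>i\<close>. Only the chart chosen in the definition of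
  the exterior derivative is treated: the differential of the Hamiltonian is defined through the same
  choice, and a single chart suffices for the Euler-Poincare equation.
\<close>

lemma ext_deriv_liouville_in_chart:
  fixes A :: "('a, 'e::real_normed_vector) atlas"
  assumes fd: "finite_dimensional TYPE('e)"
    and A: "differentiable_atlas A" and B: "differentiable_atlas (cotangent_atlas A)"
    and \<xi>: "\<xi> \<in> points (cotangent_atlas A)"
    and C: "C = (SOME C. C \<in> charts_at (cotangent_atlas A) \<xi>)"
  shows "ext_deriv (cotangent_atlas A) (liouville A) \<xi> v w
     = blinfun_apply (snd (v C)) (fst (w C)) - blinfun_apply (snd (w C)) (fst (v C))"
proof -
  have C': "C \<in> charts_at (cotangent_atlas A) \<xi>"
    unfolding C by (rule some_chart_at[OF \<xi>])
  then obtain c where c: "c \<in> charts_at A (fst \<xi>)" and Cc: "C = cotangent_chart A c"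
    by (auto simp: charts_at_cotangent_atlas)
  define b where "b u \<zeta> = liouville A (chart_inv C \<zeta>) (tvec_of (cotangent_atlas A) (chart_inv C \<zeta>) C u)" for u \<zeta>
  have "(b u has_derivative (\<lambda>h. blinfun_apply (snd h) (fst u))) (at (coord C \<xi>))" for u
  proof (rule has_derivative_transform_within_open[OF _ chart_image_open[OF B C']])
    show "((\<lambda>\<zeta>. blinfun_apply (snd \<zeta>) (fst u)) has_derivative (\<lambda>h. blinfun_apply (snd h) (fst u))) (at (coord C \<xi>))"
      by (intro bounded_linear_imp_has_derivative bounded_linear_intros)
  next
    fix \<zeta> assume "\<zeta> \<in> coord C ` cdom C"
    then obtain \<eta> where \<eta>: "\<eta> \<in> cdom C" "\<zeta> = coord C \<eta>"
      by blast
    have inv: "chart_inv C \<zeta> = \<eta>"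
      using \<eta> B C' by (simp add: chart_inv_coord_at)
    have C\<eta>: "C \<in> charts_at (cotangent_atlas A) \<eta>"
      using \<eta> C' by (simp add: charts_at_iff)
    have c\<eta>: "c \<in> charts_at A (fst \<eta>)" "snd \<eta> \<in> cotangent_space A (fst \<eta>)"
      using \<eta> c by (simp_all add: charts_at_iff Cc cdom_cotangent_chart)
    show "blinfun_apply (snd \<zeta>) (fst u) = b u \<zeta>"
      unfolding b_def inv
      using liouville_in_chart[OF fd A B c\<eta>(1) tvec_of_in_tangent_space[OF B C\<eta>] c\<eta>(2), of u]
      by (simp add: tvec_of_apply_self[OF B C\<eta>] \<eta>(2) flip: Cc)
  qed
  then have "frechet_derivative (b u) (at (coord C \<xi>)) = (\<lambda>h. blinfun_apply (snd h) (fst u))" for u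
    using frechet_derivative_at by metis
  then show ?thesis
    by (simp add: ext_deriv_def Let_def flip: C b_def)
qed

lemma hamilton_equations_in_chart:
  fixes A :: "('a, 'e::real_normed_vector) atlas"
  assumes fd: "finite_dimensional TYPE('e)"
    and A: "differentiable_atlas A" and B: "differentiable_atlas (cotangent_atlas A)"
    and X: "hamiltonian_vector_field A H XH" and \<xi>: "\<xi> \<in> points (cotangent_atlas A)"
    and C: "C = (SOME C. C \<in> charts_at (cotangent_atlas A) \<xi>)"
    and H: "(H \<circ> chart_inv C has_derivative DH) (at (coord C \<xi>))"
  shows "blinfun_apply (snd (XH \<xi> C)) \<delta>q - blinfun_apply \<delta>p (fst (XH \<xi> C)) = - DH (\<delta>q, \<delta>p)"
proof -
  have C': "C \<in> charts_at (cotangent_atlas A) \<xi>"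
    unfolding C by (rule some_chart_at[OF \<xi>])
  define w where "w = tvec_of (cotangent_atlas A) \<xi> C (\<delta>q, \<delta>p)"
  have w: "w \<in> tangent_space (cotangent_atlas A) \<xi>" "w C = (\<delta>q, \<delta>p)"
    by (simp_all add: w_def tvec_of_in_tangent_space[OF B C'] tvec_of_apply_self[OF B C'])
  have "ext_deriv (cotangent_atlas A) (liouville A) \<xi> (XH \<xi>) w = - differential (cotangent_atlas A) H \<xi> w"
    using X \<xi> w(1) by (simp add: hamiltonian_vector_field_def)
  then show ?thesis
    by (simp add: ext_deriv_liouville_in_chart[OF fd A B \<xi> C] differential_in_chart[OF B C' w(1) H] w(2))
qed

section \<open>The momentum map and the Hamiltonian in coordinates\<close>

text \<open>
  Through \<open>\<xi>\<close> passes the integral curve of the lifted field that consists of the lifts of \<open>\<xi>\<close> by the flow. Its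
  base points form the integral curve of \<open>Z\<close> through the base point of \<open>\<xi>\<close>, and the claim compares
  velocities at time 0.
\<close>

lemma canonical_lift_projects:
  fixes A :: "('a, 'e::real_normed_vector) atlas"
  assumes lift: "canonical_lift A Z Zh" and c: "c \<in> charts_at A (fst \<xi>)"
    and \<xi>: "snd \<xi> \<in> cotangent_space A (fst \<xi>)"
  shows "fst (Zh \<xi> (cotangent_chart A c)) = Z (fst \<xi>) c"
proof -
  let ?C = "cotangent_chart A c"
  obtain D \<Phi> where D: "flow_of A Z D \<Phi>" and Dh: "flow_of (cotangent_atlas A) Zh
          {(t, \<xi>). \<xi> \<in> points (cotangent_atlas A) \<and> (t, fst \<xi>) \<in> D}
          (\<lambda>t. cotangent_lift A {x. (t, x) \<in> D} (\<Phi> t))"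
    using lift by (auto simp: canonical_lift_def)
  have x: "fst \<xi> \<in> points A" and \<xi>p: "\<xi> \<in> points (cotangent_atlas A)"
    using \<xi> charts_at_imp_points[OF c] by (simp_all add: points_cotangent_atlas)
  define T where "T = {t. (t, fst \<xi>) \<in> D}"
  define \<gamma> where "\<gamma> t = cotangent_lift A {x. (t, x) \<in> D} (\<Phi> t) \<xi>" for t
  have base: "\<Phi> 0 (fst \<xi>) = fst \<xi>" "0 \<in> T" "integral_curve A Z T (\<lambda>t. \<Phi> t (fst \<xi>))"
    using D x unfolding flow_of_def T_def by blast+
  have lifted: "\<gamma> 0 = \<xi>" "integral_curve (cotangent_atlas A) Zh T \<gamma>"
    using Dh \<xi>p unfolding flow_of_def T_def \<gamma>_def by (simp_all add: \<xi>p)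
  have C: "?C \<in> charts_at (cotangent_atlas A) (\<gamma> 0)"
    using c \<xi> lifted(1) by (auto simp: charts_at_cotangent_atlas)
  have "(coord ?C \<circ> \<gamma>) differentiable (at 0)"
    using smooth_curve_in_chart(1)[of T "cotangent_atlas A" \<gamma> 0 ?C] base(2) C lifted(2)
    by (simp add: integral_curve_def)
  moreover have "vector_derivative (coord ?C \<circ> \<gamma>) (at 0) = Zh \<xi> ?C"
  proof -
    have "velocity (cotangent_atlas A) \<gamma> 0 = Zh \<xi>"
      using lifted base(2) by (simp add: integral_curve_def)
    from fun_cong[OF this, of ?C] show ?thesis
      using C by (simp add: velocity_def)
  qed
  ultimately have "(coord ?C \<circ> \<gamma> has_vector_derivative Zh \<xi> ?C) (at 0)"
    by (simp add: vector_derivative_works)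
  then have "((\<lambda>t. fst ((coord ?C \<circ> \<gamma>) t)) has_vector_derivative fst (Zh \<xi> ?C)) (at 0)"
    by (rule bounded_linear.has_vector_derivative[OF bounded_linear_fst])
  moreover have "(\<lambda>t. fst ((coord ?C \<circ> \<gamma>) t)) = coord c \<circ> (\<lambda>t. \<Phi> t (fst \<xi>))"
    by (simp add: fun_eq_iff coord_cotangent_chart \<gamma>_def cotangent_lift_def split_beta)
  ultimately have "vector_derivative (coord c \<circ> (\<lambda>t. \<Phi> t (fst \<xi>))) (at 0) = fst (Zh \<xi> ?C)"
    by (simp add: vector_derivative_at)
  moreover have "velocity A (\<lambda>t. \<Phi> t (fst \<xi>)) 0 c = Z (fst \<xi>) c"
    using base by (simp add: integral_curve_def)
  ultimately show ?thesis
    using c base(1) by (simp add: velocity_def)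
qed

lemma liouville_canonical_lift:
  fixes A :: "('a, 'e::real_normed_vector) atlas"
  assumes A: "differentiable_atlas A" and B: "differentiable_atlas (cotangent_atlas A)"
    and Z: "vector_field A Z" and lift: "canonical_lift A Z Zh"
    and \<xi>: "\<xi> \<in> points (cotangent_atlas A)"
  shows "liouville A \<xi> (Zh \<xi>) = snd \<xi> (Z (fst \<xi>))"
proof -
  obtain c where c: "c \<in> charts_at A (fst \<xi>)" and \<alpha>: "snd \<xi> \<in> cotangent_space A (fst \<xi>)"
    using \<xi> points_iff_charts_at[of "fst \<xi>" A] by (auto simp: points_cotangent_atlas)
  have x: "fst \<xi> \<in> points A"
    using \<xi> by (simp add: points_cotangent_atlas)
  have "Zh \<xi> \<in> tangent_space (cotangent_atlas A) \<xi>"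
    using lift \<xi> vector_field_in_tangent_space by (auto simp: canonical_lift_def)
  then show ?thesis
    using tangent_map_projection[OF A B c _ \<alpha>, of "Zh \<xi>"] canonical_lift_projects[OF lift c \<alpha>]
      tvec_of_tangent_vector[OF vector_field_in_tangent_space[OF Z x] c]
    by (simp add: liouville_def)
qed

lemma momentum_apply:
  fixes A :: "('a, 'e::real_normed_vector) atlas" and \<phi> :: "'g::real_normed_vector \<Rightarrow> 'a \<Rightarrow> ('a, 'e) tvec"
  assumes fd: "finite_dimensional TYPE('g)"
    and A: "differentiable_atlas A" and B: "differentiable_atlas (cotangent_atlas A)"
    and \<phi>: "lie_action A br \<phi>" and lift: "\<And>X. canonical_lift A (\<phi> X) (\<phi>h X)"
    and \<xi>: "\<xi> \<in> points (cotangent_atlas A)"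
  shows "blinfun_apply (momentum A \<phi>h \<xi>) X = snd \<xi> (\<phi> X (fst \<xi>))"
proof -
  have vf: "vector_field A (\<phi> X)" for X
    using \<phi> by (simp add: lie_action_def)
  have x: "fst \<xi> \<in> points A" and \<alpha>: "snd \<xi> \<in> cotangent_space A (fst \<xi>)"
    using \<xi> by (simp_all add: points_cotangent_atlas)
  have "linear (\<lambda>X. snd \<xi> (\<phi> X (fst \<xi>)))"
    using \<phi> x \<alpha> vector_field_in_tangent_space[OF vf x]
    by (intro linearI) (simp_all add: lie_action_def cotangent_space_def)
  then show ?thesis
    by (simp add: momentum_def liouville_canonical_lift[OF A B vf lift \<xi>] bounded_linear_Blinfun_apply
        linear_imp_bounded_linear[OF fd])
qed

text \<open>
  The charts of the tangent bundle are linear on fibres, so a line in the tangent space at \<open>x\<close> is a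
  line in the fibre coordinate.
\<close>

lemma legendre_is_fibre_derivative:
  fixes A :: "('a, 'e::real_normed_vector) atlas"
  assumes A: "differentiable_atlas A" and c: "c \<in> charts_at A x" and v: "v \<in> tangent_space A x"
    and L: "(L \<circ> chart_inv (tangent_chart A c) has_derivative DL) (at (coord c x, v c))"
  shows "snd (legendre A L (x, v)) (tvec_of A x c u) = DL (0, u)"
proof -
  let ?C = "tangent_chart A c"
  let ?u = "tvec_of A x c u"
  have u: "?u \<in> tangent_space A x"
    by (rule tvec_of_in_tangent_space[OF A c])
  have "L (x, \<lambda>d. v d + s *\<^sub>R ?u d) = (L \<circ> chart_inv ?C) (coord c x, v c + s *\<^sub>R u)" for s
  proof -
    have "(\<lambda>d. v d + s *\<^sub>R ?u d) \<in> tangent_space A x"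
      by (intro tangent_space_add tangent_space_scaleR A u v)
    from chart_inv_tangent_chart[OF A c this] show ?thesis
      by (simp add: tvec_of_apply_self[OF A c])
  qed
  moreover have "((\<lambda>s. (L \<circ> chart_inv ?C) (coord c x, v c + s *\<^sub>R u)) has_derivative (\<lambda>s. DL (0, s *\<^sub>R u))) (at 0)"
    by (rule has_derivative_compose[where g = "L \<circ> chart_inv ?C" and g' = DL])
      (use L in \<open>auto intro!: derivative_eq_intros\<close>)
  moreover have "DL (0, s *\<^sub>R u) = s * DL (0, u)" for s
    using linear_scale[OF has_derivative_linear[OF L], of s "(0, u)"] by simp
  ultimately have "((\<lambda>s. L (x, \<lambda>d. v d + s *\<^sub>R ?u d)) has_real_derivative DL (0, u)) (at 0)"
    by (simp add: has_field_derivative_def mult_commute_abs)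
  then show ?thesis
    using u by (simp add: legendre_def DERIV_imp_deriv)
qed

text \<open>
  Here \<open>g\<close> is the coordinate of the velocity that corresponds to \<open>\<xi>\<close> under the Legendre map. In
  classical notation: \<open>\<partial>H/\<partial>p = g\<close>, \<open>\<partial>H/\<partial>q = - \<partial>L/\<partial>q\<close> and \<open>p = \<partial>L/\<partial>u\<close>. Writing \<open>H\<close> as a
  function of \<open>(q, p)\<close> by means of the differentiable inverse of the Legendre map, rather than
  differentiating \<open>H\<close> along the Legendre map, avoids second derivatives of \<open>L\<close>.
\<close>

lemma differential_of_hamiltonian_in_chart:
  fixes A :: "('a, 'e::real_normed_vector) atlas"
  assumes fd: "finite_dimensional TYPE('e)"
    and A: "differentiable_atlas A" and B: "differentiable_atlas (cotangent_atlas A)"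
    and L: "smooth_map (tangent_atlas A) (open_atlas UNIV) L"
    and reg: "hyperregular A L" and H: "comes_from_lagrangian A H L"
    and c: "c \<in> charts_at A (fst \<xi>)" and \<xi>: "snd \<xi> \<in> cotangent_space A (fst \<xi>)"
    and C: "C = cotangent_chart A c"
  obtains g DL DH where
    "(L \<circ> chart_inv (tangent_chart A c) has_derivative DL) (at (coord c (fst \<xi>), g))"
    "\<And>u. DL (0, u) = blinfun_apply (snd (coord C \<xi>)) u"
    "(H \<circ> chart_inv C has_derivative DH) (at (coord C \<xi>))"
    "\<And>\<delta>q \<delta>p. DH (\<delta>q, \<delta>p) = blinfun_apply \<delta>p g - DL (\<delta>q, 0)"
proof -
  let ?T = "tangent_chart A c" and ?TA = "tangent_atlas A" and ?CA = "cotangent_atlas A"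
  let ?L = "L \<circ> chart_inv ?T"
  define G where "G = inv_into (points ?TA) (legendre A L)"
  have bij: "bij_betw (legendre A L) (points ?TA) (points ?CA)" and G: "smooth_map ?CA ?TA G"
    using reg by (auto simp: hyperregular_def diffeomorphism_def G_def)
  have C': "C \<in> charts_at ?CA \<xi>"
    using c \<xi> C by (auto simp: charts_at_cotangent_atlas)
  have G_props: "fst (G \<eta>) = fst \<eta>" "snd (G \<eta>) \<in> tangent_space A (fst \<eta>)" "legendre A L (G \<eta>) = \<eta>"
    if "\<eta> \<in> points ?CA" for \<eta>
  proof -
    have G\<eta>: "G \<eta> \<in> points ?TA" and \<eta>: "legendre A L (G \<eta>) = \<eta>"
      using bij that by (simp_all add: G_def bij_betw_def inv_into_into f_inv_into_f)
    show "legendre A L (G \<eta>) = \<eta>"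
      by (rule \<eta>)
    have "fst (legendre A L \<zeta>) = fst \<zeta>" for \<zeta>
      by (simp add: legendre_def split_beta)
    from this[of "G \<eta>"] show fst: "fst (G \<eta>) = fst \<eta>"
      by (simp add: \<eta>)
    show "snd (G \<eta>) \<in> tangent_space A (fst \<eta>)"
      using G\<eta> points_tangent_atlas[of "fst (G \<eta>)" "snd (G \<eta>)" A] by (simp flip: fst)
  qed
  have C_pts: "\<eta> \<in> points ?CA" "c \<in> charts_at A (fst \<eta>)" "snd \<eta> \<in> cotangent_space A (fst \<eta>)"
    if "\<eta> \<in> cdom C" for \<eta>
  proof -
    show c\<eta>: "c \<in> charts_at A (fst \<eta>)" and \<alpha>: "snd \<eta> \<in> cotangent_space A (fst \<eta>)"
      using that C c by (simp_all add: cdom_cotangent_chart charts_at_iff)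
    show "\<eta> \<in> points ?CA"
      using \<alpha> charts_at_imp_points[OF c\<eta>] by (simp add: points_cotangent_atlas)
  qed
  have \<xi>C: "\<xi> \<in> cdom C"
    using C' by (simp add: charts_at_iff)
  define x where "x = fst \<xi>"
  define v where "v = snd (G \<xi>)"
  have v: "v \<in> tangent_space A x" and G\<xi>: "G \<xi> = (x, v)"
    using G_props[OF C_pts(1)[OF \<xi>C]] by (simp_all add: x_def v_def prod_eq_iff)
  have leg: "legendre A L (x, v) = \<xi>"
    using G_props(3)[OF C_pts(1)[OF \<xi>C]] by (simp add: G\<xi>)
  have cx: "c \<in> charts_at A x"
    using c by (simp add: x_def)
  have T: "?T \<in> charts_at ?TA (x, v)"
    using v cx by (auto simp: charts_at_tangent_atlas)
  have "Chart UNIV id \<in> charts_at (open_atlas UNIV) (L (x, v))"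
    by (simp add: charts_at_iff open_atlas_def)
  from smooth_map_imp_differentiable[OF L T this]
  have "?L differentiable (at (coord c x, v c))"
    by (simp add: coord_tangent_chart)
  then obtain DL where DL: "(?L has_derivative DL) (at (coord c x, v c))"
    by (auto simp: differentiable_def)
  have fibre: "DL (0, u) = blinfun_apply (snd (coord C \<xi>)) u" for u
    using legendre_is_fibre_derivative[OF A cx v DL, of u, unfolded leg] \<xi>
    by (simp add: C coord_cotangent_chart covec_coord_apply[OF fd A c] x_def)
  \<comment> \<open>\<open>\<gamma>\<close> is the inverse Legendre map in coordinates; it preserves base points.\<close>
  define \<gamma> where "\<gamma> \<zeta> = snd (G (chart_inv C \<zeta>)) c" for \<zeta>
  have "(coord ?T \<circ> G \<circ> chart_inv C) differentiable (at (coord C \<xi>))"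
    using smooth_map_imp_differentiable[OF G C'] T by (simp add: G\<xi>)
  then have "(\<lambda>\<zeta>. snd ((coord ?T \<circ> G \<circ> chart_inv C) \<zeta>)) differentiable (at (coord C \<xi>))"
    unfolding differentiable_def using has_derivative_snd by blast
  moreover have "snd ((coord ?T \<circ> G \<circ> chart_inv C) \<zeta>) = \<gamma> \<zeta>" for \<zeta>
    using coord_tangent_chart[of A c "fst (G (chart_inv C \<zeta>))" "snd (G (chart_inv C \<zeta>))"]
    by (simp add: \<gamma>_def)
  ultimately obtain D\<gamma> where D\<gamma>: "(\<gamma> has_derivative D\<gamma>) (at (coord C \<xi>))"
    by (auto simp: differentiable_def)
  have \<gamma>\<xi>: "\<gamma> (coord C \<xi>) = v c"
    using chart_inv_coord_at[OF B C' \<xi>C] by (simp add: \<gamma>_def v_def)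
  have q\<xi>: "fst (coord C \<xi>) = coord c x"
    by (simp add: C coord_cotangent_chart x_def)
  have "((\<lambda>\<zeta>. ?L (fst \<zeta>, \<gamma> \<zeta>)) has_derivative (\<lambda>h. DL (fst h, D\<gamma> h))) (at (coord C \<xi>))"
    by (rule has_derivative_compose[where g = ?L and g' = DL])
      (use DL D\<gamma> in \<open>auto intro!: derivative_eq_intros simp: \<gamma>\<xi> q\<xi>\<close>)
  moreover have "((\<lambda>\<zeta>. blinfun_apply (snd \<zeta>) (\<gamma> \<zeta>)) has_derivative
      (\<lambda>h. blinfun_apply (snd (coord C \<xi>)) (D\<gamma> h) + blinfun_apply (snd h) (v c))) (at (coord C \<xi>))"
    using bounded_bilinear.FDERIV[OF bounded_bilinear_blinfun_apply
        has_derivative_snd[OF has_derivative_ident] D\<gamma>] by (simp add: \<gamma>\<xi>)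
  ultimately have "((\<lambda>\<zeta>. blinfun_apply (snd \<zeta>) (\<gamma> \<zeta>) - ?L (fst \<zeta>, \<gamma> \<zeta>)) has_derivative
      (\<lambda>h. (blinfun_apply (snd (coord C \<xi>)) (D\<gamma> h) + blinfun_apply (snd h) (v c)) - DL (fst h, D\<gamma> h)))
      (at (coord C \<xi>))"
    by (intro has_derivative_diff)
  \<comment> \<open>The fibre derivative is the covector itself, so the two terms containing \<open>D\<gamma>\<close> cancel.\<close>
  moreover have "DL (fst h, D\<gamma> h) = DL (fst h, 0) + blinfun_apply (snd (coord C \<xi>)) (D\<gamma> h)" for h
    using linear_add[OF has_derivative_linear[OF DL], of "(fst h, 0)" "(0, D\<gamma> h)"] by (simp add: fibre)
  ultimately have "((\<lambda>\<zeta>. blinfun_apply (snd \<zeta>) (\<gamma> \<zeta>) - ?L (fst \<zeta>, \<gamma> \<zeta>)) has_derivative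
      (\<lambda>h. blinfun_apply (snd h) (v c) - DL (fst h, 0))) (at (coord C \<xi>))"
    by (simp add: algebra_simps)
  then have DH: "(H \<circ> chart_inv C has_derivative (\<lambda>h. blinfun_apply (snd h) (v c) - DL (fst h, 0)))
      (at (coord C \<xi>))"
  proof (rule has_derivative_transform_within_open[OF _ chart_image_open[OF B C']])
    fix \<zeta> assume "\<zeta> \<in> coord C ` cdom C"
    then obtain \<eta> where \<eta>: "\<eta> \<in> cdom C" "\<zeta> = coord C \<eta>"
      by blast
    note \<eta>p = C_pts[OF \<eta>(1)]
    note G\<eta> = G_props[OF \<eta>p(1)]
    have inv: "chart_inv C \<zeta> = \<eta>"
      unfolding \<eta>(2) by (rule chart_inv_coord_at[OF B C' \<eta>(1)])
    have G\<eta>p: "G \<eta> = (fst \<eta>, snd (G \<eta>))"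
      using G\<eta>(1) by (simp add: prod_eq_iff)
    have "G \<eta> \<in> points ?TA"
      using G\<eta> \<eta>p by (subst G\<eta>p) (auto simp: points_tangent_atlas points_cotangent_atlas)
    then have "H (legendre A L (G \<eta>)) = snd (legendre A L (G \<eta>)) (snd (G \<eta>)) - L (G \<eta>)"
      using H unfolding comes_from_lagrangian_def split_beta prod.collapse by blast
    then have "H \<eta> = snd \<eta> (snd (G \<eta>)) - L (G \<eta>)"
      by (simp add: G\<eta>(3))
    also have "snd \<eta> (snd (G \<eta>)) = blinfun_apply (snd \<zeta>) (\<gamma> \<zeta>)"
      using covec_apply_in_chart[OF fd A \<eta>p(2,3) G\<eta>(2)]
      by (simp add: \<gamma>_def inv) (simp add: \<eta>(2) C coord_cotangent_chart)
    also have "L (G \<eta>) = ?L (fst \<zeta>, \<gamma> \<zeta>)"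
    proof -
      have "(fst \<zeta>, \<gamma> \<zeta>) = (coord c (fst \<eta>), snd (G \<eta>) c)"
        by (simp add: \<gamma>_def inv) (simp add: \<eta>(2) C coord_cotangent_chart)
      then show ?thesis
        using G\<eta>p chart_inv_tangent_chart[OF A \<eta>p(2) G\<eta>(2)] by simp
    qed
    finally show "blinfun_apply (snd \<zeta>) (\<gamma> \<zeta>) - ?L (fst \<zeta>, \<gamma> \<zeta>) = (H \<circ> chart_inv C) \<zeta>"
      by (simp add: inv)
  qed
  show thesis
    by (rule that[OF _ fibre DH]) (use DL in \<open>simp_all add: x_def\<close>)
qed

section \<open>The Euler-Poincare equation\<close>

text \<open>
  For \<open>Z = \<phi> X\<close> the function on the left is \<open>lagrangian_bar L \<phi>\<close> at a fixed Lie algebra element \<open>X\<close>; the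
  derivative of \<open>Z\<close> enters through the fibre argument of \<open>L\<close>.
\<close>

lemma lagrangian_along_vector_field_has_derivative:
  assumes A: "differentiable_atlas A" and c: "c \<in> charts_at A x" and Z: "vector_field A Z"
    and L: "(L \<circ> chart_inv (tangent_chart A c) has_derivative DL) (at (coord c x, Z x c))"
    and DZ: "((\<lambda>z. Z (chart_inv c z) c) has_derivative DZ) (at (coord c x))"
  shows "((\<lambda>y. L (y, Z y)) \<circ> chart_inv c has_derivative (\<lambda>h. DL (h, DZ h))) (at (coord c x))"
proof (rule has_derivative_transform_within_open[OF _ chart_image_open[OF A c]])
  have x: "chart_inv c (coord c x) = x"
    using chart_inv_coord_at[OF A c] c by (simp add: charts_at_iff)
  show "((\<lambda>z. (L \<circ> chart_inv (tangent_chart A c)) (z, Z (chart_inv c z) c)) has_derivative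
      (\<lambda>h. DL (h, DZ h))) (at (coord c x))"
    by (rule has_derivative_compose[where g = "L \<circ> chart_inv (tangent_chart A c)" and g' = DL])
      (use L DZ in \<open>auto intro!: derivative_eq_intros simp: x\<close>)
next
  fix z assume "z \<in> coord c ` cdom c"
  then obtain y where y: "y \<in> cdom c" "z = coord c y"
    by blast
  then have cy: "c \<in> charts_at A y"
    using c by (simp add: charts_at_iff)
  show "(L \<circ> chart_inv (tangent_chart A c)) (z, Z (chart_inv c z) c)
      = ((\<lambda>y. L (y, Z y)) \<circ> chart_inv c) z"
    using chart_inv_tangent_chart[OF A cy vector_field_in_tangent_space[OF Z charts_at_imp_points[OF cy]]]
      chart_inv_coord_at[OF A c y(1)] y(2) by simp
qed

lemma ad_star_apply:
  fixes br :: "'g::real_normed_vector \<Rightarrow> 'g \<Rightarrow> 'g"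
  assumes "lie_algebra br"
  shows "blinfun_apply (ad_star br X \<zeta>) Y = blinfun_apply \<zeta> (br X Y)"
proof -
  have "linear (br X)" and fd: "finite_dimensional TYPE('g)"
    using assms by (simp_all add: lie_algebra_def bilinear_def)
  then have "linear (\<lambda>Y. blinfun_apply \<zeta> (br X Y))"
    by (intro linearI) (simp_all add: linear_add linear_scale blinfun.add_right blinfun.scaleR_right)
  then show ?thesis
    by (simp add: ad_star_def bounded_linear_Blinfun_apply linear_imp_bounded_linear[OF fd])
qed

theorem proposition5p2p1:
  fixes A :: "('a, 'e::real_normed_vector) atlas"
    and br :: "'g::real_normed_vector \<Rightarrow> 'g \<Rightarrow> 'g"
    and \<phi> :: "'g \<Rightarrow> 'a \<Rightarrow> ('a, 'e) tvec"
    and \<phi>h :: "'g \<Rightarrow> ('a, 'e) ctbundle \<Rightarrow> (('a, 'e) ctbundle, 'e \<times> ('e \<Rightarrow>\<^sub>L real)) tvec"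
    and J :: "('a, 'e) ctbundle \<Rightarrow> ('g \<Rightarrow>\<^sub>L real)"
    and H :: "('a, 'e) ctbundle \<Rightarrow> real"
    and L :: "('a, 'e) tbundle \<Rightarrow> real"
    and XH :: "('a, 'e) ctbundle \<Rightarrow> (('a, 'e) ctbundle, 'e \<times> ('e \<Rightarrow>\<^sub>L real)) tvec"
    and I :: "real set"
    and \<psi> :: "real \<Rightarrow> ('a, 'e) ctbundle"
    and V :: "real \<Rightarrow> 'g"
  assumes "smooth_manifold A"
    and "lie_algebra br"
    and "lie_action A br \<phi>"
    and "locally_transitive A \<phi>"
    and "\<And>X. canonical_lift A (\<phi> X) (\<phi>h X)"
    and "J = momentum A \<phi>h"
    and "smooth_map (tangent_atlas A) (open_atlas UNIV) L"
    and "hyperregular A L"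
    and "smooth_map (cotangent_atlas A) (open_atlas UNIV) H"
    and "comes_from_lagrangian A H L"
    and "hamiltonian_vector_field A H XH"
    and "open_interval I"
    and "integral_curve (cotangent_atlas A) XH I \<psi>"
    and "smooth_on I V"
    and "\<And>t. t \<in> I \<Longrightarrow> \<phi> (V t) (fst (\<psi> t)) = velocity A (fst \<circ> \<psi>) t"
  shows "\<forall>t\<in>I. (J \<circ> \<psi>) differentiable (at t) \<and>
           vector_derivative (J \<circ> \<psi>) (at t) - ad_star br (V t) ((J \<circ> \<psi>) t)
             = J (partial_differential1 A (lagrangian_bar L \<phi>) (fst (\<psi> t)) (V t))"
proof
  fix t assume t: "t \<in> I"
  let ?B = "cotangent_atlas A"
  have fd: "finite_dimensional TYPE('e)" and fdg: "finite_dimensional TYPE('g)"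
    using assms(1,2) by (simp_all add: smooth_manifold_def lie_algebra_def)
  have A: "differentiable_atlas A"
    using assms(1) by (simp add: smooth_manifold_def smooth_atlas_imp_differentiable_atlas)
  have B: "differentiable_atlas ?B"
    using vector_field_imp_differentiable_cotangent_atlas[OF fd A, of XH] assms(11)
    by (simp add: hamiltonian_vector_field_def)
  have vf: "vector_field A (\<phi> X)" for X
    using assms(3) by (simp add: lie_action_def)
  have \<psi>: "smooth_map (open_atlas I) ?B \<psi>" "velocity ?B \<psi> t = XH (\<psi> t)"
    using assms(13) t by (simp_all add: integral_curve_def)
  have J: "blinfun_apply (J \<xi>) X = snd \<xi> (\<phi> X (fst \<xi>))" if "\<xi> \<in> points ?B" for \<xi> X
    unfolding assms(6) by (rule momentum_apply[OF fdg A B assms(3,5) that])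
  have \<psi>_pts: "\<psi> s \<in> points ?B" if "s \<in> I" for s
    using \<psi>(1) that by (auto simp: smooth_map_def open_atlas_def points_def)
  define x where "x = fst (\<psi> t)"
  define C where "C = (SOME C. C \<in> charts_at ?B (\<psi> t))"
  have C: "C \<in> charts_at ?B (\<psi> t)"
    unfolding C_def by (rule some_chart_at[OF \<psi>_pts[OF t]])
  then obtain c where c: "c \<in> charts_at A x" and Cc: "C = cotangent_chart A c"
    and \<alpha>: "snd (\<psi> t) \<in> cotangent_space A x"
    by (auto simp: charts_at_cotangent_atlas x_def)
  have x: "x \<in> points A" and cinv: "chart_inv c (coord c x) = x"
    using charts_at_imp_points[OF c] chart_inv_coord_at[OF A c] c by (simp_all add: charts_at_iff)
  define q where "q s = coord c (fst (\<psi> s))" for s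
  define p where "p s = covec_coord A c (fst (\<psi> s)) (snd (\<psi> s))" for s
  have coord_\<psi>: "coord C (\<psi> s) = (q s, p s)" for s
    by (simp add: Cc coord_cotangent_chart q_def p_def)
  have qt: "q t = coord c x"
    by (simp add: q_def x_def)
  define q' where "q' = fst (XH (\<psi> t) C)"
  define p' where "p' = snd (XH (\<psi> t) C)"

  obtain S where S: "open S" "t \<in> S" "S \<subseteq> I" "\<And>s. s \<in> S \<Longrightarrow> \<psi> s \<in> cdom C"
    using smooth_curve_in_chart(2)[OF \<psi>(1) t C] by blast
  have "vector_derivative (coord C \<circ> \<psi>) (at t) = XH (\<psi> t) C"
    using fun_cong[OF \<psi>(2), of C] C by (simp add: velocity_def)
  then have "(coord C \<circ> \<psi> has_vector_derivative XH (\<psi> t) C) (at t)"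
    using smooth_curve_in_chart(1)[OF \<psi>(1) t C] by (simp add: vector_derivative_works)
  then have "((\<lambda>s. (q s, p s)) has_vector_derivative (q', p')) (at t)"
    by (simp add: o_def coord_\<psi> q'_def p'_def)
  from bounded_linear.has_vector_derivative[OF bounded_linear_fst this]
    bounded_linear.has_vector_derivative[OF bounded_linear_snd this]
  have Dq: "(q has_vector_derivative q') (at t)" and Dp: "(p has_vector_derivative p') (at t)"
    by simp_all

  \<comment> \<open>Hamilton's equations split into \<open>p' = \<partial>L/\<partial>q\<close> and \<open>q' = g\<close>; the latter says that the
    velocity corresponding to \<open>\<psi> t\<close> under the Legendre map is that of the base curve.\<close>
  obtain g DL DH where
    DL: "(L \<circ> chart_inv (tangent_chart A c) has_derivative DL) (at (coord c x, g))"
    and fibre: "\<And>u. DL (0, u) = blinfun_apply (p t) u"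
    and DH: "(H \<circ> chart_inv C has_derivative DH) (at (coord C (\<psi> t)))"
    and DH_eq: "\<And>\<delta>q \<delta>p. DH (\<delta>q, \<delta>p) = blinfun_apply \<delta>p g - DL (\<delta>q, 0)"
    using differential_of_hamiltonian_in_chart[OF fd A B assms(7,8,10) c[unfolded x_def] \<alpha>[unfolded x_def] Cc]
    by (metis coord_\<psi> snd_conv x_def)
  have DL0: "DL (0, 0) = 0"
    by (simp add: fibre)
  have hamilton: "blinfun_apply p' \<delta>q - blinfun_apply \<delta>p q' = DL (\<delta>q, 0) - blinfun_apply \<delta>p g"
    for \<delta>q and \<delta>p :: "'e \<Rightarrow>\<^sub>L real"
    using hamilton_equations_in_chart[OF fd A B assms(11) \<psi>_pts[OF t] C_def DH, of \<delta>q \<delta>p]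
    by (simp add: DH_eq q'_def p'_def)
  have p'_eq: "blinfun_apply p' \<delta>q = DL (\<delta>q, 0)" for \<delta>q
    using hamilton[of \<delta>q 0] by simp
  have "blinfun_apply \<delta>p g = blinfun_apply \<delta>p q'" for \<delta>p :: "'e \<Rightarrow>\<^sub>L real"
    using hamilton[of 0 \<delta>p] by (simp add: DL0)
  then have g: "g = q'"
    by (rule dual_separates_points[OF fd])

  define f where "f X z = \<phi> X (chart_inv c z) c" for X z
  define Df where "Df X = frechet_derivative (f X) (at (coord c x))" for X
  have Df: "(f X has_derivative Df X) (at (coord c x))" for X
    using vector_field_differentiable[OF vf[of X] c] frechet_derivative_works
    unfolding Df_def f_def by blast
  have f_x: "f X (coord c x) = \<phi> X x c" for X
    by (simp add: f_def cinv)
  have q'_eq: "q' = \<phi> (V t) x c"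
  proof -
    have "velocity A (fst \<circ> \<psi>) t c = vector_derivative q (at t)"
      using c by (simp add: velocity_def x_def q_def[abs_def] o_def)
    then show ?thesis
      using assms(15)[OF t] vector_derivative_at[OF Dq] by (simp add: x_def)
  qed
  have J_chart: "blinfun_apply (J (\<psi> s)) X = blinfun_apply (p s) (f X (q s))" if "s \<in> S" for s X
  proof -
    have s: "\<psi> s \<in> points ?B" "fst (\<psi> s) \<in> points A" "c \<in> charts_at A (fst (\<psi> s))" "fst (\<psi> s) \<in> cdom c"
      using \<psi>_pts S(3) S(4)[OF that] that c
      by (auto simp: Cc points_cotangent_atlas cdom_cotangent_chart charts_at_iff)
    have "snd (\<psi> s) (\<phi> X (fst (\<psi> s))) = blinfun_apply (p s) (\<phi> X (fst (\<psi> s)) c)"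
      unfolding p_def using s
      by (intro covec_apply_in_chart[OF fd A] vector_field_in_tangent_space[OF vf])
        (simp_all add: points_cotangent_atlas)
    then show ?thesis
      using s(4) by (simp add: J[OF s(1)] f_def q_def chart_inv_coord_at[OF A c])
  qed

  define R where "R = J (partial_differential1 A (lagrangian_bar L \<phi>) x (V t))"
  have ad: "blinfun_apply (ad_star br (V t) (J (\<psi> t))) X
      = blinfun_apply (p t) (Df X q' - Df (V t) (f X (q t)))" for X
  proof -
    have "\<phi> (br (V t) X) x c = Df X q' - Df (V t) (f X (q t))"
      using assms(3) x c
      by (simp add: lie_action_def lie_bracket_def q'_eq f_x qt) (simp add: Df_def f_def[abs_def])
    then show ?thesis
      by (simp add: ad_star_apply[OF assms(2)] J_chart[OF S(2)]) (simp add: qt f_x)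
  qed
  have R: "blinfun_apply R X = blinfun_apply p' (f X (q t)) + blinfun_apply (p t) (Df (V t) (f X (q t)))" for X
  proof -
    let ?l = "\<lambda>y. lagrangian_bar L \<phi> y (V t)"
    have D: "(?l \<circ> chart_inv c has_derivative (\<lambda>h. DL (h, Df (V t) h))) (at (coord c x))"
      unfolding lagrangian_bar_def
      by (rule lagrangian_along_vector_field_has_derivative[OF A c vf])
        (use DL Df[of "V t"] in \<open>simp_all add: g q'_eq f_def[abs_def]\<close>)
    have "(x, differential A ?l x) \<in> points ?B"
      using x differential_in_cotangent_space[OF A c D] by (simp add: points_cotangent_atlas)
    then have "blinfun_apply R X = differential A ?l x (\<phi> X x)"
      by (simp add: R_def partial_differential1_def J)
    also have "\<dots> = DL (f X (q t), Df (V t) (f X (q t)))"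
      using differential_in_chart[OF A c vector_field_in_tangent_space[OF vf x] D] by (simp add: qt f_x)
    also have "\<dots> = DL (f X (q t), 0) + DL (0, Df (V t) (f X (q t)))"
      using linear_add[OF has_derivative_linear[OF DL], of "(f X (q t), 0)" "(0, Df (V t) (f X (q t)))"]
      by simp
    finally show ?thesis
      by (simp add: p'_eq fibre)
  qed
  have "((\<lambda>s. blinfun_apply (J (\<psi> s)) X) has_vector_derivative
      blinfun_apply (R + ad_star br (V t) (J (\<psi> t))) X) (at t)" for X
  proof -
    have "(f X \<circ> q has_vector_derivative Df X q') (at t)"
      by (rule vector_derivative_diff_chain_within[OF Dq])
        (use Df[of X] in \<open>simp add: qt has_derivative_at_withinI\<close>)
    from bounded_bilinear.has_vector_derivative[OF bounded_bilinear_blinfun_apply Dp this]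
    have "((\<lambda>s. blinfun_apply (p s) (f X (q s))) has_vector_derivative
        blinfun_apply (p t) (Df X q') + blinfun_apply p' (f X (q t))) (at t)"
      by simp
    then have "((\<lambda>s. blinfun_apply (J (\<psi> s)) X) has_vector_derivative
        blinfun_apply (p t) (Df X q') + blinfun_apply p' (f X (q t))) (at t)"
      by (rule has_vector_derivative_transform_within_open[OF _ S(1,2)]) (simp add: J_chart)
    then show ?thesis
      by (simp add: blinfun.add_left R ad blinfun.diff_right add.commute)
  qed
  from has_vector_derivative_blinfun_pointwise[OF fdg this]
  have DJ: "(J \<circ> \<psi> has_vector_derivative R + ad_star br (V t) (J (\<psi> t))) (at t)"
    by (simp add: o_def)
  then show "(J \<circ> \<psi>) differentiable (at t) \<and>
      vector_derivative (J \<circ> \<psi>) (at t) - ad_star br (V t) ((J \<circ> \<psi>) t)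
        = J (partial_differential1 A (lagrangian_bar L \<phi>) (fst (\<psi> t)) (V t))"
    using vector_derivative_at[OF DJ] differentiableI_vector[OF DJ]
    by (simp add: R_def x_def)
qed

end
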